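(* Let $C_n$ be a cycle of even length $n\ge 4$. Then $\operatorname{depth}\bigl(R/I(C_n)^{[k]}\bigr)=2k-1$ for $k=\nu(C_n)-1=\lfloor\frac{n}{2}\rfloor-1$.
   Context: All graphs are finite and simple. Fix a field $\mathbb{K}$. For a graph $G$ with vertex set $V(G)$ (vertices are identified with indeterminates), $R=\mathbb{K}[x\mid x\in V(G)]$ and $I(G)=\langle xy\mid \{x,y\}\in E(G)\rangle\subseteq R$ is the edge ideal. A $k$-matching of $G$ is a set of $k$ pairwise disjoint edges; $\nu(G)$ is the maximum cardinality of a matching. The $k$-th square-free power $I(G)^{[k]}$ is the ideal of $R$ generated by the square-free monomials of $I(G)^k$; equivalently it is generated by the products $\prod_{x\in \bigcup_{e\in M}e}x$ over all $k$-matchings $M$ of $G$. The cycle $C_n$ has vertices $x_1,\dots,x_n$ and edges $\{x_i,x_{i+1}\}$ for $1\le i\le n-1$ and $\{x_1,x_n\}$; here $R=\mathbb{K}[x_1,\dots,x_n]$. *)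

theory Defs
  imports
    "HOL-Library.Poly_Mapping"
    "HOL-Library.Disjoint_Sets"
    "HOL-Library.Extended_Nat"
    "HOL-Algebra.Module"
    "HOL-Algebra.QuotRing"
    "HOL-Algebra.Ideal_Product"
begin

section \<open>Graphs and matchings\<close>

record 'v ugraph =
  verts :: "'v set"
  edges :: "'v set set"

definition simple_graph :: "'v ugraph \<Rightarrow> bool" where
  "simple_graph G \<longleftrightarrow> finite (verts G) \<and> (\<forall>e\<in>edges G. e \<subseteq> verts G \<and> card e = 2)"

definition matching :: "'v ugraph \<Rightarrow> 'v set set \<Rightarrow> bool" where
  "matching G M \<longleftrightarrow> M \<subseteq> edges G \<and> disjoint M"

definition matching_number :: "'v ugraph \<Rightarrow> nat" where
  "matching_number G = Max {card M | M. matching G M}"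

definition cycle_graph :: "nat \<Rightarrow> nat ugraph" where
  "cycle_graph n =
     \<lparr>verts = {1..n}, edges = {{i, i + 1} | i. 1 \<le> i \<and> i \<le> n - 1} \<union> {{1, n}}\<rparr>"

lemma simple_graph_cycle: "3 \<le> n \<Longrightarrow> simple_graph (cycle_graph n)"
  by (auto simp: simple_graph_def cycle_graph_def)


section \<open>Polynomial rings\<close>

text \<open>
  A monomial is its exponent vector, of type \<^typ>\<open>'v \<Rightarrow>\<^sub>0 nat\<close>, and a polynomial is a finitely
  supported map from monomials to coefficients.  The type admits all elements of \<^typ>\<open>'v\<close> as
  variables; \<open>mpoly_ring V\<close> keeps only the polynomials in the variables from \<open>V\<close>.
\<close>

type_synonym ('v, 'k) mpoly = "('v \<Rightarrow>\<^sub>0 nat) \<Rightarrow>\<^sub>0 'k"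

definition monomial :: "('v \<Rightarrow>\<^sub>0 nat) \<Rightarrow> ('v, 'k::field) mpoly" where
  "monomial m = Poly_Mapping.single m 1"

definition variable :: "'v \<Rightarrow> ('v, 'k::field) mpoly" where
  "variable x = monomial (Poly_Mapping.single x 1)"

definition mpoly_ring :: "'v set \<Rightarrow> ('v, 'k::field) mpoly ring" where
  "mpoly_ring V =
     \<lparr>carrier = {p. \<forall>m\<in>Poly_Mapping.keys p. Poly_Mapping.keys m \<subseteq> V},
      mult = (*), one = 1, zero = 0, add = (+)\<rparr>"

lemma cring_mpoly_ring: "cring (mpoly_ring V :: ('v, 'k::field) mpoly ring)"
proof -
  let ?R = "mpoly_ring V :: ('v, 'k) mpoly ring"
  let ?C = "{p :: ('v, 'k) mpoly. \<forall>m\<in>Poly_Mapping.keys p. Poly_Mapping.keys m \<subseteq> V}"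
  have R: "carrier ?R = ?C" "mult ?R = (*)" "one ?R = 1" "zero ?R = 0" "add ?R = (+)"
    by (simp_all add: mpoly_ring_def)
  have const: "0 \<in> ?C" "1 \<in> ?C" by simp_all
  have add: "p + q \<in> ?C" if "p \<in> ?C" "q \<in> ?C" for p q
    using that Poly_Mapping.keys_add[of p q] by blast
  have mult: "p * q \<in> ?C" if p: "p \<in> ?C" and q: "q \<in> ?C" for p q
  proof (intro CollectI ballI)
    fix m assume "m \<in> Poly_Mapping.keys (p * q)"
    then obtain a b where "m = a + b" "a \<in> Poly_Mapping.keys p" "b \<in> Poly_Mapping.keys q"
      using Poly_Mapping.keys_mult[of p q] by blast
    then show "Poly_Mapping.keys m \<subseteq> V"
      using p q Poly_Mapping.keys_add[of a b] by blast
  qed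
  have inv: "\<exists>q\<in>?C. q + p = 0" if "p \<in> ?C" for p
    using that by (intro bexI[of _ "- p"]) simp_all
  show ?thesis
  proof (rule cringI)
    show "abelian_group ?R"
      by (rule abelian_groupI, unfold R)
        (rule add const inv add.assoc add.commute add_0 | assumption)+
    show "comm_monoid ?R"
      by (rule comm_monoidI, unfold R)
        (rule mult const mult.assoc mult.commute mult_1 | assumption)+
  qed (unfold R, rule distrib_right)
qed

definition irrelevant_ideal :: "'v set \<Rightarrow> ('v, 'k::field) mpoly set" where
  "irrelevant_ideal V = Idl\<^bsub>mpoly_ring V\<^esub> (variable ` V)"


section \<open>Edge ideals and their square-free powers\<close>

abbreviation graph_ring :: "'v ugraph \<Rightarrow> ('v, 'k::field) mpoly ring" where
  "graph_ring G \<equiv> mpoly_ring (verts G)"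

definition edge_ideal :: "'v ugraph \<Rightarrow> ('v, 'k::field) mpoly set" where
  "edge_ideal G = Idl\<^bsub>graph_ring G\<^esub> {variable x * variable y | x y. {x, y} \<in> edges G}"

definition squarefree_exponent :: "('v \<Rightarrow>\<^sub>0 nat) \<Rightarrow> bool" where
  "squarefree_exponent m \<longleftrightarrow> (\<forall>x. Poly_Mapping.lookup m x \<le> 1)"

text \<open>
  The ordinary power of an ideal is taken in the monoid \<^const>\<open>ideals_set\<close> of ideals under
  the product of ideals.
\<close>

definition squarefree_power :: "'v ugraph \<Rightarrow> nat \<Rightarrow> ('v, 'k::field) mpoly set" where
  "squarefree_power G k =
     Idl\<^bsub>graph_ring G\<^esub>
       {monomial m | m. squarefree_exponent m \<and>
          monomial m \<in> (edge_ideal G [^]\<^bsub>ideals_set (graph_ring G :: ('v, 'k) mpoly ring)\<^esub> k)}"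


section \<open>Depth\<close>

definition quotient_module :: "('a, 'r) ring_scheme \<Rightarrow> 'a set \<Rightarrow> ('a, 'a set) module" where
  "quotient_module R I = ring.extend (R Quot I)
     (module.fields (\<lambda>r u. (I +>\<^bsub>R\<^esub> r) \<otimes>\<^bsub>R Quot I\<^esub> u))"

lemma module_quotient_module:
  assumes "cring R" and "ideal I R"
  shows "module R (quotient_module R I)"
proof -
  interpret cring R by fact
  interpret ideal I R by fact
  interpret Q: cring "R Quot I" by (rule quotient_is_cring) fact
  interpret h: ring_hom_ring R "R Quot I" "(+>\<^bsub>R\<^esub>) I" by (rule rcos_ring_hom_ring)
  let ?M = "quotient_module R I"
  have M: "carrier ?M = carrier (R Quot I)" "add ?M = add (R Quot I)" "zero ?M = zero (R Quot I)"
    "smult ?M = (\<lambda>r u. (I +>\<^bsub>R\<^esub> r) \<otimes>\<^bsub>R Quot I\<^esub> u)"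
    by (simp_all add: quotient_module_def ring.defs module.defs)
  show ?thesis
  proof (rule moduleI)
    show "abelian_group ?M"
    proof (rule abelian_groupI, unfold M)
      fix u assume "u \<in> carrier (R Quot I)"
      then show "\<exists>v\<in>carrier (R Quot I). v \<oplus>\<^bsub>R Quot I\<^esub> u = \<zero>\<^bsub>R Quot I\<^esub>"
        by (intro bexI[of _ "\<ominus>\<^bsub>R Quot I\<^esub> u"]) (simp_all add: Q.l_neg)
    qed (simp_all add: Q.a_ac)
  qed (simp_all only: M is_cring h.hom_add h.hom_mult h.hom_one h.hom_closed Q.m_closed
      Q.l_distr Q.r_distr Q.m_assoc Q.l_one)
qed

text \<open>The submodule \<open>(F) M\<close> of \<open>M\<close>, where \<open>(F)\<close> is the ideal generated by \<open>F\<close>.\<close>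

definition smult_submodule ::
    "('a, 'r) ring_scheme \<Rightarrow> ('a, 'b, 'm) module_scheme \<Rightarrow> 'a set \<Rightarrow> 'b set" where
  "smult_submodule R M F =
     \<Inter>{N. submodule N R M \<and> {f \<odot>\<^bsub>M\<^esub> u | f u. f \<in> F \<and> u \<in> carrier M} \<subseteq> N}"

text \<open>
  The first condition says that each \<open>f\<^sub>i\<close> is a nonzerodivisor on \<open>M / (f\<^sub>1, \<dots>, f\<^sub>i\<^sub>-\<^sub>1) M\<close>,
  the second that \<open>M \<noteq> (f\<^sub>1, \<dots>, f\<^sub>r) M\<close>.
\<close>

definition regular_sequence ::
    "('a, 'r) ring_scheme \<Rightarrow> ('a, 'b, 'm) module_scheme \<Rightarrow> 'a list \<Rightarrow> bool" where
  "regular_sequence R M fs \<longleftrightarrow> set fs \<subseteq> carrier R \<and>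
     (\<forall>i<length fs. \<forall>u\<in>carrier M.
        fs ! i \<odot>\<^bsub>M\<^esub> u \<in> smult_submodule R M (set (take i fs)) \<longrightarrow>
        u \<in> smult_submodule R M (set (take i fs))) \<and>
     smult_submodule R M (set fs) \<noteq> carrier M"

text \<open>
  The supremum of the lengths of the \<open>M\<close>-regular sequences in the ideal \<open>J\<close>.  For a finitely
  generated graded module over a polynomial ring, \<open>J\<close> the irrelevant ideal, this is the depth of
  \<open>M\<close>.  The zero module has no regular sequences in this sense and gets the value \<open>0\<close>.
\<close>

definition grade :: "('a, 'r) ring_scheme \<Rightarrow> 'a set \<Rightarrow> ('a, 'b, 'm) module_scheme \<Rightarrow> enat" where
  "grade R J M = Sup {enat (length fs) | fs. set fs \<subseteq> J \<and> regular_sequence R M fs}"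

definition depth :: "'v set \<Rightarrow> (('v, 'k::field) mpoly, 'b, 'm) module_scheme \<Rightarrow> enat" where
  "depth V M = grade (mpoly_ring V) (irrelevant_ideal V) M"

end

theory Submission
  imports Defs
begin

text \<open>
  Let \<open>n = 2 m\<close> and \<open>k = m - 1\<close>.  Removing one odd and one even vertex from \<open>C\<^sub>n\<close> leaves paths with
  an even number of vertices, so \<open>I = I(C\<^sub>n)\<^bsup>[k]\<^esup>\<close> is spanned by the monomials whose support misses at
  most one odd and at most one even vertex.  We have to show that \<open>R/I\<close> has depth \<open>n - 3\<close>.

  Lower bound: the elementary symmetric polynomials \<open>e\<^sub>n\<^sub>-\<^sub>3, \<dots>, e\<^sub>1\<close> form a regular sequence.  For an
  exact sequence \<open>0 \<rightarrow> R/(N : x) \<rightarrow> R/N \<rightarrow> R/(N + x) \<rightarrow> 0\<close> it suffices that they are regular on the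
  outer terms, and splitting along all variables reduces \<open>R/I\<close> to quotients by at most three
  variables.  There, if exactly \<open>d\<close> variables are left, \<open>e\<^sub>d\<close> is their product, and splitting along these
  variables lowers \<open>d\<close>; surplus variables are added to the front of the sequence and dropped again
  by a degree argument.

  Upper bound: a regular sequence of length \<open>r\<close> in the irrelevant ideal shifts a nonzero class in
  Koszul homology of degree \<open>j\<close> to one of degree \<open>j + r\<close>, so \<open>j + r \<le> n\<close>.  An explicit class in degree
  \<open>3\<close> comes from the four-cycle \<open>1, 2, 3, 4\<close>.
\<close>

section \<open>Ideals of a subring\<close>

text \<open>Lower bound: a filtration argument on weakly regular sequences needs one sequence that
  works for all quotients by variables at once. Symmetric polynomials supply it, because they single
  out no set of variables. The number three comes from a pigeonhole: variables are killed only while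
  at most one odd and at most one even vertex is gone, so the last kill is at most the third.

  Upper bound: the class lives in multidegree (1,...,1). The sets \<open>S\<close> for which the
  product of the variables outside \<open>S\<close> lies in \<open>I\<close> are those with at most
  one odd and at most one even vertex, hence the faces of the complete bipartite graph on odd and
  even vertices. This graph is the upper Koszul complex of \<open>I\<close> in that degree. It
  contains a four-cycle and has no triangle to fill it, so its first reduced homology, and with it
  Tor_2 of \<open>I\<close> and Tor_3 of \<open>R/I\<close>, is nonzero. To represent the class over
  \<open>R/I\<close>, the cycle is filled in the full simplex, where triangles are available; the
  boundary of the filling then has coefficients in \<open>I\<close>.\<close>

locale subring_ideals =
  fixes C :: "'a::comm_ring_1 set"
  assumes zero_mem [simp]: "0 \<in> C" and one_mem [simp]: "1 \<in> C"
    and add_mem [simp]: "\<lbrakk>a \<in> C; b \<in> C\<rbrakk> \<Longrightarrow> a + b \<in> C"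
    and uminus_mem [simp]: "a \<in> C \<Longrightarrow> - a \<in> C"
    and mult_mem [simp]: "\<lbrakk>a \<in> C; b \<in> C\<rbrakk> \<Longrightarrow> a * b \<in> C"
begin

lemma diff_mem [simp]: "\<lbrakk>a \<in> C; b \<in> C\<rbrakk> \<Longrightarrow> a - b \<in> C"
  using add_mem[of a "- b"] by simp

lemma sum_mem: "(\<And>x. x \<in> A \<Longrightarrow> f x \<in> C) \<Longrightarrow> sum f A \<in> C"
  by (induction A rule: infinite_finite_induct) auto

text \<open>The ring is a subset \<open>C\<close> of a type, so that computations use the type class
  operations. The carrier-based ideals of the statement are matched with this notion in
  \<open>ideal_mpoly_ring_iff\<close>.\<close>

definition is_ideal :: "'a set \<Rightarrow> bool" where
  "is_ideal N \<longleftrightarrow> N \<subseteq> C \<and> 0 \<in> N \<and> (\<forall>a\<in>N. \<forall>b\<in>N. a + b \<in> N) \<and> (\<forall>r\<in>C. \<forall>a\<in>N. r * a \<in> N)"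

lemma is_ideal_subset: "is_ideal N \<Longrightarrow> a \<in> N \<Longrightarrow> a \<in> C"
  and is_ideal_zero: "is_ideal N \<Longrightarrow> 0 \<in> N"
  and is_ideal_add: "is_ideal N \<Longrightarrow> a \<in> N \<Longrightarrow> b \<in> N \<Longrightarrow> a + b \<in> N"
  and is_ideal_mult: "is_ideal N \<Longrightarrow> r \<in> C \<Longrightarrow> a \<in> N \<Longrightarrow> r * a \<in> N"
  by (auto simp: is_ideal_def)

lemma is_ideal_uminus: "is_ideal N \<Longrightarrow> a \<in> N \<Longrightarrow> - a \<in> N"
  using is_ideal_mult[of N "- 1" a] by simp

lemma is_ideal_diff: "is_ideal N \<Longrightarrow> a \<in> N \<Longrightarrow> b \<in> N \<Longrightarrow> a - b \<in> N"
  using is_ideal_add[of N a "- b"] is_ideal_uminus[of N b] by simp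

lemma is_ideal_sum: "is_ideal N \<Longrightarrow> (\<And>x. x \<in> A \<Longrightarrow> f x \<in> N) \<Longrightarrow> sum f A \<in> N"
  by (induction A rule: infinite_finite_induct) (auto simp: is_ideal_zero is_ideal_add)

lemma is_ideal_carrier: "is_ideal C"
  by (simp add: is_ideal_def)

definition adjoin :: "'a set \<Rightarrow> 'a \<Rightarrow> 'a set" where
  "adjoin N f = {a + f * r | a r. a \<in> N \<and> r \<in> C}"

lemma adjoinI: "a \<in> N \<Longrightarrow> r \<in> C \<Longrightarrow> a + f * r \<in> adjoin N f"
  by (auto simp: adjoin_def)

lemma adjoinE:
  assumes "u \<in> adjoin N f"
  obtains a r where "a \<in> N" "r \<in> C" "u = a + f * r"
  using assms by (auto simp: adjoin_def)

lemma is_ideal_adjoin: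
  assumes N: "is_ideal N" and f: "f \<in> C"
  shows "is_ideal (adjoin N f)"
  unfolding is_ideal_def
proof (intro conjI ballI subsetI)
  show "u \<in> C" if "u \<in> adjoin N f" for u
    using that f is_ideal_subset[OF N] by (auto simp: adjoin_def)
  show "0 \<in> adjoin N f"
    using adjoinI[of 0 N 0 f] is_ideal_zero[OF N] by simp
  show "u + v \<in> adjoin N f" if u: "u \<in> adjoin N f" and v: "v \<in> adjoin N f" for u v
  proof -
    obtain a r where 1: "a \<in> N" "r \<in> C" "u = a + f * r" using u by (rule adjoinE)
    obtain b s where 2: "b \<in> N" "s \<in> C" "v = b + f * s" using v by (rule adjoinE)
    show ?thesis
      using adjoinI[of "a + b" N "r + s" f] 1 2 is_ideal_add[OF N] by (simp add: algebra_simps)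
  qed
  show "c * u \<in> adjoin N f" if c: "c \<in> C" and u: "u \<in> adjoin N f" for c u
  proof -
    obtain a r where 1: "a \<in> N" "r \<in> C" "u = a + f * r" using u by (rule adjoinE)
    show ?thesis
      using adjoinI[OF is_ideal_mult[OF N c 1(1)] mult_mem[OF c 1(2)], of f] 1
      by (simp add: distrib_left mult.left_commute)
  qed
qed

lemma subset_adjoin: "a \<in> N \<Longrightarrow> a \<in> adjoin N f"
  using adjoinI[of a N 0 f] by simp

lemma mult_mem_adjoin: "is_ideal N \<Longrightarrow> r \<in> C \<Longrightarrow> f * r \<in> adjoin N f"
  using adjoinI[of 0 N r f] is_ideal_zero[of N] by simp

lemma self_mem_adjoin: "is_ideal N \<Longrightarrow> f \<in> adjoin N f"
  using mult_mem_adjoin[of N 1 f] by simp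

lemma adjoin_least: "is_ideal K \<Longrightarrow> N \<subseteq> K \<Longrightarrow> f \<in> K \<Longrightarrow> adjoin N f \<subseteq> K"
  by (auto simp: adjoin_def mult.commute[of f] intro!: is_ideal_add[of K] is_ideal_mult[of K])

lemma adjoin_commute:
  assumes "is_ideal N" "f \<in> C" "g \<in> C"
  shows "adjoin (adjoin N f) g = adjoin (adjoin N g) f"
proof -
  have "adjoin (adjoin N f) g \<subseteq> adjoin (adjoin N g) f" if "f \<in> C" "g \<in> C" for f g
    using assms(1) that
    by (intro adjoin_least is_ideal_adjoin subsetI)
      (auto intro: self_mem_adjoin subset_adjoin is_ideal_adjoin)
  then show ?thesis using assms by blast
qed

text \<open>Lets an elementary symmetric polynomial be traded for a single monomial congruent to
  it.\<close>

lemma adjoin_cong: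
  assumes N: "is_ideal N" and "f \<in> C" "g \<in> C" and fg: "f - g \<in> N"
  shows "adjoin N f = adjoin N g"
proof -
  have "adjoin N f \<subseteq> adjoin N g" if "f \<in> C" "g \<in> C" "f - g \<in> N" for f g
  proof (rule adjoin_least)
    show "f \<in> adjoin N g" using adjoinI[of "f - g" N 1 g] that by simp
  qed (use N that in \<open>auto intro: is_ideal_adjoin subset_adjoin\<close>)
  then show ?thesis using assms is_ideal_uminus[OF N fg] by fastforce
qed

definition colon :: "'a set \<Rightarrow> 'a \<Rightarrow> 'a set" where
  "colon N g = {r \<in> C. g * r \<in> N}"

lemma is_ideal_colon:
  assumes N: "is_ideal N" and g: "g \<in> C"
  shows "is_ideal (colon N g)"
  using is_ideal_zero[OF N] is_ideal_add[OF N] is_ideal_mult[OF N]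
  by (auto simp: is_ideal_def colon_def distrib_left mult.left_commute[of g])


section \<open>Weakly regular sequences\<close>

definition nonzerodivisor_mod :: "'a set \<Rightarrow> 'a \<Rightarrow> bool" where
  "nonzerodivisor_mod N f \<longleftrightarrow> (\<forall>u\<in>C. f * u \<in> N \<longrightarrow> u \<in> N)"

text \<open>Properness of the quotients is left out on purpose: the unit ideal turns up among the
  colon and sum ideals of the inductions, and there every sequence is acceptable. Properness is
  checked once, when the depth is computed.\<close>

fun weakly_regular :: "'a set \<Rightarrow> 'a list \<Rightarrow> bool" where
  "weakly_regular N [] \<longleftrightarrow> True"
| "weakly_regular N (f # fs) \<longleftrightarrow> nonzerodivisor_mod N f \<and> weakly_regular (adjoin N f) fs"

lemma nonzerodivisor_modD: "nonzerodivisor_mod N f \<Longrightarrow> u \<in> C \<Longrightarrow> f * u \<in> N \<Longrightarrow> u \<in> N"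
  by (simp add: nonzerodivisor_mod_def)

lemma nonzerodivisor_mod_cong:
  assumes N: "is_ideal N" and fg: "f - g \<in> N"
  shows "nonzerodivisor_mod N f \<longleftrightarrow> nonzerodivisor_mod N g"
proof -
  have "f * u \<in> N \<longleftrightarrow> g * u \<in> N" if "u \<in> C" for u
  proof -
    have "u * (f - g) \<in> N" using is_ideal_mult[OF N that fg] .
    then show ?thesis
      using is_ideal_add[OF N, of "u * (f - g)" "g * u"] is_ideal_diff[OF N, of "f * u" "u * (f - g)"]
      by (auto simp: algebra_simps)
  qed
  then show ?thesis by (auto simp: nonzerodivisor_mod_def)
qed

lemma weakly_regular_carrier: "set fs \<subseteq> C \<Longrightarrow> weakly_regular C fs"
proof (induction fs)
  case (Cons f fs)
  have "adjoin C f = C"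
    using Cons.prems adjoin_least[OF is_ideal_carrier, of C f] subset_adjoin[of _ C f] by auto
  then show ?case using Cons by (simp add: nonzerodivisor_mod_def)
qed simp

text \<open>This is the behaviour of regular sequences along the exact sequence
  \<open>0 \<rightarrow> R/(N : g) \<rightarrow> R/N \<rightarrow> R/(N + g) \<rightarrow> 0\<close>.\<close>

lemma weakly_regular_exact:
  assumes "is_ideal N" "g \<in> C" "set fs \<subseteq> C"
    and "weakly_regular (colon N g) fs" "weakly_regular (adjoin N g) fs"
  shows "weakly_regular N fs"
  using assms
proof (induction fs arbitrary: N)
  case (Cons f fs)
  note N = Cons.prems(1) and g = Cons.prems(2)
  have f: "f \<in> C" and fs: "set fs \<subseteq> C" using Cons.prems by auto
  have nzd_colon: "nonzerodivisor_mod (colon N g) f" and nzd_adjoin: "nonzerodivisor_mod (adjoin N g) f"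
    and reg: "weakly_regular (adjoin (colon N g) f) fs" "weakly_regular (adjoin (adjoin N g) f) fs"
    using Cons.prems by auto
  have "nonzerodivisor_mod N f"
    unfolding nonzerodivisor_mod_def
  proof (intro ballI impI)
    fix u assume u: "u \<in> C" "f * u \<in> N"
    \<comment> \<open>Chase \<open>u\<close> through the sequence: its image in the right term
      vanishes, so it comes from some \<open>r\<close> in the left term, where \<open>f\<close>
      cancels as well.\<close>
    have "u \<in> adjoin N g"
      using nonzerodivisor_modD[OF nzd_adjoin] u subset_adjoin by blast
    then obtain a r where ar: "a \<in> N" "r \<in> C" "u = a + g * r" by (rule adjoinE)
    have "f * u - f * a \<in> N" using is_ideal_diff[OF N u(2)] is_ideal_mult[OF N f ar(1)] by blast
    then have "g * (f * r) \<in> N" using ar by (simp add: algebra_simps)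
    then have "f * r \<in> colon N g" using ar f by (simp add: colon_def)
    then have "r \<in> colon N g" using nonzerodivisor_modD[OF nzd_colon] ar by blast
    then show "u \<in> N" using ar is_ideal_add[OF N] by (simp add: colon_def)
  qed
  \<comment> \<open>Reducing the sequence modulo \<open>f\<close> keeps it exact on the left because
    \<open>f\<close> is regular on the right term. This identifies the colon ideal required by the
    induction hypothesis for \<open>N + f\<close>.\<close>
  moreover have "colon (adjoin N f) g = adjoin (colon N g) f"
  proof
    show "colon (adjoin N f) g \<subseteq> adjoin (colon N g) f"
    proof
      fix v assume "v \<in> colon (adjoin N f) g"
      then have v: "v \<in> C" "g * v \<in> adjoin N f" by (auto simp: colon_def)
      from v(2) obtain a w where aw: "a \<in> N" "w \<in> C" "g * v = a + f * w" by (rule adjoinE)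
      have "f * w = - a + g * v" using aw by (simp add: algebra_simps)
      then have "f * w \<in> adjoin N g"
        using adjoinI[OF is_ideal_uminus[OF N aw(1)] v(1)] by simp
      then have "w \<in> adjoin N g" using nonzerodivisor_modD[OF nzd_adjoin] aw by blast
      then obtain b s where bs: "b \<in> N" "s \<in> C" "w = b + g * s" by (rule adjoinE)
      have "g * (v - f * s) = a + f * b" using aw bs by (simp add: algebra_simps)
      also have "\<dots> \<in> N" using aw bs f is_ideal_add[OF N] is_ideal_mult[OF N] by blast
      finally have "v - f * s \<in> colon N g" using v bs f by (simp add: colon_def)
      from adjoinI[OF this bs(2), of f] show "v \<in> adjoin (colon N g) f" by simp
    qed
    show "adjoin (colon N g) f \<subseteq> colon (adjoin N f) g"
      using N f g mult_mem_adjoin[OF N g, of f]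
      by (intro adjoin_least is_ideal_colon is_ideal_adjoin)
        (auto simp: colon_def mult.commute intro: subset_adjoin)
  qed
  ultimately show ?case
    using Cons.IH[of "adjoin N f"] N f g fs reg adjoin_commute[OF N f g]
    by (simp add: is_ideal_adjoin)
qed simp

section \<open>Ideals generated by a list over a base ideal\<close>

lemma is_ideal_foldl_adjoin:
  "is_ideal N \<Longrightarrow> set fs \<subseteq> C \<Longrightarrow> is_ideal (foldl adjoin N fs)"
  by (induction fs arbitrary: N) (auto simp: is_ideal_adjoin)

lemma subset_foldl_adjoin: "N \<subseteq> foldl adjoin N fs"
proof (induction fs arbitrary: N)
  case (Cons f fs)
  have "N \<subseteq> adjoin N f" by (auto intro: subset_adjoin)
  also have "\<dots> \<subseteq> foldl adjoin (adjoin N f) fs" by (rule Cons.IH)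
  finally show ?case by simp
qed simp

lemma set_subset_foldl_adjoin:
  "is_ideal N \<Longrightarrow> set fs \<subseteq> C \<Longrightarrow> set fs \<subseteq> foldl adjoin N fs"
proof (induction fs arbitrary: N)
  case (Cons f fs)
  have "f \<in> foldl adjoin (adjoin N f) fs"
    using subset_foldl_adjoin self_mem_adjoin[OF Cons.prems(1)] by blast
  then show ?case using Cons by (simp add: is_ideal_adjoin)
qed simp

lemma foldl_adjoin_least:
  "is_ideal K \<Longrightarrow> N \<subseteq> K \<Longrightarrow> set fs \<subseteq> K \<Longrightarrow> foldl adjoin N fs \<subseteq> K"
  by (induction fs arbitrary: N) (auto simp: adjoin_least)

text \<open>Connects the recursion, which suits inductions, with the indexed condition in
  \<open>regular_sequence\<close>.\<close>

lemma weakly_regular_iff: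
  "weakly_regular N fs \<longleftrightarrow>
    (\<forall>i<length fs. nonzerodivisor_mod (foldl adjoin N (take i fs)) (fs ! i))"
  by (induction fs arbitrary: N) (simp_all add: All_less_Suc2)

end


section \<open>Koszul chains\<close>

text \<open>A chain of degree \<open>j\<close> assigns to each \<open>j\<close>-subset \<open>S\<close> of \<open>V\<close> the coefficient of the
  exterior basis element with index set \<open>S\<close>.  All homology is taken modulo an ideal \<open>N\<close>, with
  chains over the subring \<open>C\<close> itself.\<close>

locale koszul = subring_ideals C for C :: "'a::comm_ring_1 set" +
  fixes V :: "'v::linorder set" and X :: "'v \<Rightarrow> 'a"
  assumes finite_V: "finite V" and X_mem: "x \<in> V \<Longrightarrow> X x \<in> C"
begin

text \<open>The exponent is the position at which \<open>x\<close> enters the increasing enumeration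
  of \<open>S\<close>. Counting inside \<open>V\<close> keeps it finite for arbitrary
  \<open>S\<close>, so the sign rules need no finiteness condition.\<close>

definition sgn_at :: "'v \<Rightarrow> 'v set \<Rightarrow> 'a" where
  "sgn_at x S = (- 1) ^ card {y \<in> V. y \<in> S \<and> y < x}"

text \<open>The Koszul differential in coefficient form: the basis element of \<open>T\<close> goes
  to the signed sum of \<open>X x\<close> times that of \<open>T - {x}\<close>, so the coefficient
  at \<open>S\<close> collects from the sets \<open>insert x S\<close>.\<close>

definition bd :: "('v set \<Rightarrow> 'a) \<Rightarrow> 'v set \<Rightarrow> 'a" where
  "bd c S = (\<Sum>x\<in>V - S. sgn_at x S * X x * c (insert x S))"

definition wedge :: "'v \<Rightarrow> ('v set \<Rightarrow> 'a) \<Rightarrow> 'v set \<Rightarrow> 'a" where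
  "wedge x c S = (if x \<in> S then sgn_at x (S - {x}) * c (S - {x}) else 0)"

definition chain :: "nat \<Rightarrow> ('v set \<Rightarrow> 'a) \<Rightarrow> bool" where
  "chain j c \<longleftrightarrow> (\<forall>S. c S \<in> C \<and> (c S \<noteq> 0 \<longrightarrow> S \<subseteq> V \<and> card S = j))"

definition chain_in :: "'a set \<Rightarrow> ('v set \<Rightarrow> 'a) \<Rightarrow> bool" where
  "chain_in N c \<longleftrightarrow> (\<forall>S. c S \<in> N)"

lemma sgn_at_mem [simp]: "sgn_at x S \<in> C"
  by (cases "even (card {y \<in> V. y \<in> S \<and> y < x})") (auto simp: sgn_at_def)

lemma sgn_at_square [simp]: "sgn_at x S * sgn_at x S = 1"
  by (simp add: sgn_at_def flip: power_add power_mult_distrib)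

lemma sgn_at_cancel [simp]: "sgn_at x S * (sgn_at x S * a) = a"
  by (simp flip: mult.assoc)

lemma sgn_at_insert:
  assumes "x \<in> V" "x \<notin> S"
  shows "sgn_at y (insert x S) = (if x < y then - sgn_at y S else sgn_at y S)"
proof (cases "x < y")
  case True
  then have "{z \<in> V. z \<in> insert x S \<and> z < y} = insert x {z \<in> V. z \<in> S \<and> z < y}"
    using assms by auto
  then have "card {z \<in> V. z \<in> insert x S \<and> z < y} = Suc (card {z \<in> V. z \<in> S \<and> z < y})"
    using assms finite_V by simp
  then show ?thesis using True by (simp add: sgn_at_def)
next
  case False
  then have "{z \<in> V. z \<in> insert x S \<and> z < y} = {z \<in> V. z \<in> S \<and> z < y}" by auto
  then show ?thesis using False by (simp add: sgn_at_def)
qed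

lemma sgn_at_antisym:
  assumes "x \<in> V" "y \<in> V" "x \<notin> S" "y \<notin> S" "x \<noteq> y"
  shows "sgn_at x S * sgn_at y (insert x S) = - (sgn_at y S * sgn_at x (insert y S))"
  using assms by (auto simp: sgn_at_insert mult.commute)

lemma bd_bd: "bd (bd c) S = 0"
proof -
  let ?t = "\<lambda>x y. sgn_at x S * X x * (sgn_at y (insert x S) * X y * c (insert y (insert x S)))"
  let ?W = "V - S"
  have fin: "finite ?W" using finite_V by simp
  have anti: "?t x y = - ?t y x" if "x \<in> ?W" "y \<in> ?W" "x \<noteq> y" for x y
  proof -
    have "?t x y = (sgn_at x S * sgn_at y (insert x S)) * (X x * X y * c (insert y (insert x S)))"
      by (simp add: ac_simps)
    also have "\<dots> = - (sgn_at y S * sgn_at x (insert y S)) * (X x * X y * c (insert y (insert x S)))"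
      using that by (subst sgn_at_antisym) auto
    also have "\<dots> = - ?t y x" by (simp add: ac_simps insert_commute)
    finally show ?thesis .
  qed
  have "bd (bd c) S = (\<Sum>x\<in>?W. \<Sum>y\<in>V - insert x S. ?t x y)"
    by (simp add: bd_def sum_distrib_left)
  \<comment> \<open>Antisymmetry of the summand only shows that twice the sum vanishes, which is
    void in characteristic 2. Splitting by the order of \<open>x\<close> and \<open>y\<close> makes
    the two halves cancel outright.\<close>
  also have "\<dots> = (\<Sum>x\<in>?W. (\<Sum>y\<in>{y \<in> ?W. x < y}. ?t x y) + (\<Sum>y\<in>{y \<in> ?W. y < x}. ?t x y))"
  proof (rule sum.cong[OF refl])
    fix x assume "x \<in> ?W"
    have eq: "V - insert x S = {y \<in> ?W. x < y} \<union> {y \<in> ?W. y < x}" by auto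
    show "(\<Sum>y\<in>V - insert x S. ?t x y) = (\<Sum>y\<in>{y \<in> ?W. x < y}. ?t x y) + (\<Sum>y\<in>{y \<in> ?W. y < x}. ?t x y)"
      unfolding eq using finite_V by (intro sum.union_disjoint) auto
  qed
  also have "\<dots> = (\<Sum>x\<in>?W. \<Sum>y\<in>{y \<in> ?W. x < y}. ?t x y) + (\<Sum>x\<in>?W. \<Sum>y\<in>{y \<in> ?W. y < x}. ?t x y)"
    by (rule sum.distrib)
  also have "(\<Sum>x\<in>?W. \<Sum>y\<in>{y \<in> ?W. y < x}. ?t x y) = (\<Sum>y\<in>?W. \<Sum>x\<in>{x \<in> ?W. y < x}. ?t x y)"
    using fin by (rule sum.swap_restrict[OF _ fin])
  also have "\<dots> = (\<Sum>y\<in>?W. \<Sum>x\<in>{x \<in> ?W. y < x}. - ?t y x)"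
    by (intro sum.cong refl anti) auto
  also have "(\<Sum>x\<in>?W. \<Sum>y\<in>{y \<in> ?W. x < y}. ?t x y) + \<dots> = 0"
    by (simp add: sum_negf)
  finally show ?thesis .
qed

text \<open>The differential is an antiderivation: it sends the wedge of \<open>x\<close> with
  \<open>c\<close> to \<open>X x\<close> times \<open>c\<close> minus the wedge of \<open>x\<close>
  with the differential of \<open>c\<close>. So wedging is a homotopy from zero to multiplication by
  \<open>X x\<close>.\<close>

lemma wedge_homotopy:
  assumes x: "x \<in> V"
  shows "bd (wedge x c) S + wedge x (bd c) S = X x * c S"
proof (cases "x \<in> S")
  case True
  define T where "T = S - {x}"
  have S: "S = insert x T" and xT: "x \<notin> T" using True by (auto simp: T_def)
  have VT: "V - T = insert x (V - S)" "x \<notin> V - S" using x S xT by auto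
  have "bd (wedge x c) S = (\<Sum>y\<in>V - S. sgn_at y S * X y * (sgn_at x (insert y T) * c (insert y T)))"
    unfolding bd_def
  proof (intro sum.cong refl)
    fix y assume "y \<in> V - S"
    then have "insert y S - {x} = insert y T" using S xT by auto
    then show "sgn_at y S * X y * wedge x c (insert y S)
      = sgn_at y S * X y * (sgn_at x (insert y T) * c (insert y T))"
      using S by (simp add: wedge_def)
  qed
  also have "\<dots> = - (\<Sum>y\<in>V - S. sgn_at x T * (sgn_at y T * X y * c (insert y T)))"
    unfolding sum_negf[symmetric]
  proof (intro sum.cong refl)
    fix y assume y: "y \<in> V - S"
    have "sgn_at y S * X y * (sgn_at x (insert y T) * c (insert y T))
        = (sgn_at y (insert x T) * sgn_at x (insert y T)) * (X y * c (insert y T))"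
      by (simp add: S ac_simps)
    also have "sgn_at y (insert x T) * sgn_at x (insert y T) = - (sgn_at x T * sgn_at y T)"
      using x y S xT by (auto simp: sgn_at_insert)
    finally show "sgn_at y S * X y * (sgn_at x (insert y T) * c (insert y T))
      = - (sgn_at x T * (sgn_at y T * X y * c (insert y T)))"
      by (simp add: ac_simps)
  qed
  finally have 1: "bd (wedge x c) S = - (\<Sum>y\<in>V - S. sgn_at x T * (sgn_at y T * X y * c (insert y T)))" .
  have "wedge x (bd c) S = (\<Sum>y\<in>V - T. sgn_at x T * (sgn_at y T * X y * c (insert y T)))"
    using True by (simp add: wedge_def T_def[symmetric] bd_def sum_distrib_left)
  also have "\<dots> = sgn_at x T * sgn_at x T * (X x * c S)
      + (\<Sum>y\<in>V - S. sgn_at x T * (sgn_at y T * X y * c (insert y T)))"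
    unfolding VT(1) using finite_V VT(2) by (subst sum.insert) (simp_all add: S mult.assoc)
  finally show ?thesis using 1 by simp
next
  case False
  have "bd (wedge x c) S = (\<Sum>y\<in>V - S. if y = x then X x * c S else 0)"
    unfolding bd_def
  proof (intro sum.cong refl)
    fix y assume y: "y \<in> V - S"
    show "sgn_at y S * X y * wedge x c (insert y S) = (if y = x then X x * c S else 0)"
    proof (cases "y = x")
      case True
      have "sgn_at x S * X x * (sgn_at x S * c S) = (sgn_at x S * sgn_at x S) * (X x * c S)"
        by (simp only: ac_simps)
      then show ?thesis using True \<open>x \<notin> S\<close> by (simp add: wedge_def)
    qed (use \<open>x \<notin> S\<close> in \<open>simp add: wedge_def\<close>)
  qed
  also have "\<dots> = X x * c S" using x False finite_V by (simp add: sum.delta)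
  finally show ?thesis using False by (simp add: wedge_def)
qed

text \<open>Exterior multiplication by the one-form with coefficients \<open>g\<close>.\<close>

definition homotopy :: "('v \<Rightarrow> 'a) \<Rightarrow> ('v set \<Rightarrow> 'a) \<Rightarrow> 'v set \<Rightarrow> 'a" where
  "homotopy g c S = (\<Sum>x\<in>V. g x * wedge x c S)"

lemma bd_add: "bd (\<lambda>S. c S + d S) S = bd c S + bd d S"
  and bd_diff: "bd (\<lambda>S. c S - d S) S = bd c S - bd d S"
  and bd_smult: "bd (\<lambda>S. r * c S) S = r * bd c S"
  by (simp_all add: bd_def sum_distrib_left distrib_left right_diff_distrib mult.left_commute[of _ r]
      flip: sum.distrib sum_subtractf)

lemma bd_sum: "bd (\<lambda>S. \<Sum>i\<in>A. c i S) S = (\<Sum>i\<in>A. bd (c i) S)"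
  by (simp add: bd_def sum_distrib_left sum.swap[of _ A])

text \<open>Makes explicit that elements of the ideal generated by the \<open>X x\<close> annihilate
  Koszul homology.\<close>

lemma homotopy_formula:
  "bd (homotopy g c) S + homotopy g (bd c) S = (\<Sum>x\<in>V. X x * g x) * c S"
proof -
  have "bd (homotopy g c) S = (\<Sum>x\<in>V. g x * bd (wedge x c) S)"
    unfolding homotopy_def[abs_def] by (simp add: bd_sum bd_smult)
  then have "bd (homotopy g c) S + homotopy g (bd c) S
      = (\<Sum>x\<in>V. g x * (bd (wedge x c) S + wedge x (bd c) S))"
    by (simp add: homotopy_def sum.distrib distrib_left)
  also have "\<dots> = (\<Sum>x\<in>V. g x * (X x * c S))"
    by (intro sum.cong refl) (simp add: wedge_homotopy)
  also have "\<dots> = (\<Sum>x\<in>V. X x * g x) * c S"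
    unfolding sum_distrib_right by (intro sum.cong refl) (simp only: ac_simps)
  finally show ?thesis .
qed

lemma bd_in:
  assumes N: "is_ideal N" and c: "chain_in N c"
  shows "chain_in N (bd c)"
  unfolding chain_in_def bd_def
proof (intro allI is_ideal_sum[OF N] is_ideal_mult[OF N])
  show "c (insert x S) \<in> N" for x S using c by (simp add: chain_in_def)
qed (simp add: X_mem)

lemma wedge_in: "is_ideal N \<Longrightarrow> chain_in N c \<Longrightarrow> chain_in N (wedge x c)"
  by (simp add: chain_in_def wedge_def is_ideal_zero is_ideal_mult)

lemma homotopy_in:
  assumes N: "is_ideal N" and g: "\<And>x. x \<in> V \<Longrightarrow> g x \<in> C" and c: "chain_in N c"
  shows "chain_in N (homotopy g c)"
  unfolding chain_in_def homotopy_def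
proof (intro allI is_ideal_sum[OF N] is_ideal_mult[OF N] g)
  show "wedge x c S \<in> N" for x S using wedge_in[OF N c] by (simp add: chain_in_def)
qed

lemma chain_homotopy:
  assumes c: "chain j c" and g: "\<And>x. x \<in> V \<Longrightarrow> g x \<in> C"
  shows "chain (Suc j) (homotopy g c)"
  unfolding chain_def
proof (intro allI conjI impI)
  fix S
  have "chain_in C c" using c by (simp add: chain_in_def chain_def)
  from homotopy_in[OF is_ideal_carrier g this] show "homotopy g c S \<in> C" by (simp add: chain_in_def)
  assume "homotopy g c S \<noteq> 0"
  then obtain x where x: "x \<in> V" "g x * wedge x c S \<noteq> 0"
    unfolding homotopy_def by (rule sum.not_neutral_contains_not_neutral)
  then have xS: "x \<in> S" and nz: "c (S - {x}) \<noteq> 0" by (auto simp: wedge_def split: if_splits)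
  from nz c have sub: "S - {x} \<subseteq> V" and card: "card (S - {x}) = j" by (auto simp: chain_def)
  show "S \<subseteq> V" using sub x(1) by auto
  then have "finite S" using finite_V finite_subset by blast
  then show "card S = Suc j" using xS card by (metis card.remove)
qed

text \<open>The chain \<open>w\<close> carries no degree or support condition. The passage to
  \<open>N + f\<close> produces its bounding chain by choice, without control of degree, and this
  formulation accepts it as it is.\<close>

definition nonbounding_cycle :: "'a set \<Rightarrow> nat \<Rightarrow> ('v set \<Rightarrow> 'a) \<Rightarrow> bool" where
  "nonbounding_cycle N j c \<longleftrightarrow> chain j c \<and> chain_in N (bd c) \<and>
     \<not> (\<exists>w. chain_in C w \<and> chain_in N (\<lambda>S. c S - bd w S))"

text \<open>The homotopy splits the connecting homomorphism
  \<open>H\<^sub>j\<^sub>+\<^sub>1(R/(N + f)) \<rightarrow> H\<^sub>j(R/N)\<close>, which is onto because \<open>f\<close> annihilates Koszul homology.\<close>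

lemma nonbounding_cycle_adjoin:
  assumes N: "is_ideal N" and g: "\<And>x. x \<in> V \<Longrightarrow> g x \<in> C" and f: "f = (\<Sum>x\<in>V. X x * g x)"
    and nzd: "nonzerodivisor_mod N f" and c: "nonbounding_cycle N j c"
  shows "nonbounding_cycle (adjoin N f) (Suc j) (homotopy g c)"
  unfolding nonbounding_cycle_def
proof (intro conjI notI)
  have fC: "f \<in> C" using g X_mem unfolding f by (intro sum_mem) auto
  have cC: "chain j c" and cyc: "chain_in N (bd c)" using c by (auto simp: nonbounding_cycle_def)
  have hN: "homotopy g (bd c) S \<in> N" for S
    using homotopy_in[OF N g cyc] by (simp add: chain_in_def)
  have bdh: "bd (homotopy g c) S = f * c S - homotopy g (bd c) S" for S
    using homotopy_formula[of g c S] by (simp add: f algebra_simps)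
  show "chain (Suc j) (homotopy g c)" using chain_homotopy[OF cC g] .
  show "chain_in (adjoin N f) (bd (homotopy g c))"
    unfolding chain_in_def
  proof
    fix S
    have "bd (homotopy g c) S = - homotopy g (bd c) S + f * c S" by (simp add: bdh)
    also have "\<dots> \<in> adjoin N f"
      using cC by (intro adjoinI is_ideal_uminus N hN) (auto simp: chain_def)
    finally show "bd (homotopy g c) S \<in> adjoin N f" .
  qed
  assume "\<exists>w. chain_in C w \<and> chain_in (adjoin N f) (\<lambda>S. homotopy g c S - bd w S)"
  then obtain w where w: "chain_in C w" "chain_in (adjoin N f) (\<lambda>S. homotopy g c S - bd w S)"
    by blast
  have "\<forall>S. \<exists>a r. a \<in> N \<and> r \<in> C \<and> homotopy g c S - bd w S = a + f * r"
    using w(2) unfolding chain_in_def adjoin_def by blast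
  then obtain a r where ar: "\<And>S. a S \<in> N" "\<And>S. r S \<in> C"
      "\<And>S. homotopy g c S - bd w S = a S + f * r S"
    by metis
  \<comment> \<open>The coefficients \<open>r\<close> of \<open>f\<close> bound \<open>c\<close>:
    applying \<open>bd\<close> to the decomposition removes \<open>w\<close> and leaves
    \<open>f\<close> times \<open>c - bd r\<close> in \<open>N\<close>, where \<open>f\<close>
    cancels.\<close>
  have "chain_in N (\<lambda>S. c S - bd r S)"
    unfolding chain_in_def
  proof
    fix S
    have "bd (\<lambda>S. homotopy g c S - bd w S) S = bd a S + f * bd r S"
      unfolding ar(3) by (simp add: bd_add bd_smult)
    then have "f * (c S - bd r S) = bd a S + homotopy g (bd c) S"
      by (simp add: bd_diff bd_bd bdh algebra_simps)
    also have "\<dots> \<in> N"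
      using hN bd_in[OF N, of a] ar(1) is_ideal_add[OF N] by (simp add: chain_in_def)
    finally show "c S - bd r S \<in> N"
      using nonzerodivisor_modD[OF nzd] cC bd_in[OF is_ideal_carrier, of r] ar(2)
      by (simp add: chain_def chain_in_def)
  qed
  moreover have "chain_in C r" using ar(2) by (simp add: chain_in_def)
  ultimately show False using c by (auto simp: nonbounding_cycle_def)
qed

lemma nonbounding_cycle_degree:
  assumes N: "is_ideal N" and c: "nonbounding_cycle N j c"
  shows "j \<le> card V"
proof (rule ccontr)
  assume "\<not> j \<le> card V"
  then have "c S = 0" for S
    using c card_mono[OF finite_V, of S] unfolding nonbounding_cycle_def chain_def by blast
  then have "chain_in N (\<lambda>S. c S - bd (\<lambda>S. 0) S)" "chain_in C (\<lambda>S::'v set. 0)"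
    by (auto simp: chain_in_def bd_def is_ideal_zero N)
  then show False using c unfolding nonbounding_cycle_def by blast
qed

theorem weakly_regular_length_le:
  assumes "is_ideal N" "nonbounding_cycle N j c" "weakly_regular N fs"
    and "\<And>f. f \<in> set fs \<Longrightarrow> \<exists>g. (\<forall>x\<in>V. g x \<in> C) \<and> f = (\<Sum>x\<in>V. X x * g x)"
  shows "length fs + j \<le> card V"
  using assms
proof (induction fs arbitrary: N j c)
  case Nil
  then show ?case using nonbounding_cycle_degree by simp
next
  case (Cons f fs)
  obtain g where g: "\<And>x. x \<in> V \<Longrightarrow> g x \<in> C" "f = (\<Sum>x\<in>V. X x * g x)"
    using Cons.prems(4)[of f] by auto
  have "f \<in> C" unfolding g(2) using g(1) X_mem by (intro sum_mem) auto
  have "nonbounding_cycle (adjoin N f) (Suc j) (homotopy g c)"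
    using Cons.prems(3) by (intro nonbounding_cycle_adjoin[OF Cons.prems(1) g _ Cons.prems(2)]) auto
  then have "length fs + Suc j \<le> card V"
    using Cons.prems \<open>f \<in> C\<close> by (intro Cons.IH[of "adjoin N f"]) (auto simp: is_ideal_adjoin)
  then show ?case by simp
qed

end

section \<open>Polynomials in a set of variables\<close>

definition polys :: "'v set \<Rightarrow> ('v, 'k::field) mpoly set" where
  "polys V = carrier (mpoly_ring V)"

lemma mem_polys_iff: "p \<in> polys V \<longleftrightarrow> (\<forall>m\<in>Poly_Mapping.keys p. Poly_Mapping.keys m \<subseteq> V)"
  by (simp add: polys_def mpoly_ring_def)

interpretation polys: subring_ideals "polys V :: ('v, 'k::field) mpoly set" for V
proof
  interpret cring "mpoly_ring V :: ('v, 'k) mpoly ring" by (rule cring_mpoly_ring)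
  show "0 \<in> polys V" "1 \<in> polys V" by (simp_all add: mem_polys_iff)
  fix a b :: "('v, 'k) mpoly"
  assume a: "a \<in> polys V"
  show "- a \<in> polys V" using a by (simp add: mem_polys_iff)
  assume b: "b \<in> polys V"
  show "a + b \<in> polys V"
    using a_closed[OF a[unfolded polys_def] b[unfolded polys_def]]
    by (simp add: polys_def) (simp add: mpoly_ring_def)
  show "a * b \<in> polys V"
    using m_closed[OF a[unfolded polys_def] b[unfolded polys_def]]
    by (simp add: polys_def) (simp add: mpoly_ring_def)
qed

section \<open>Monomials and their supports\<close>

lemma sum_monomials: "p = (\<Sum>m\<in>Poly_Mapping.keys p. Poly_Mapping.single m (Poly_Mapping.lookup p m))"
  for p :: "'a \<Rightarrow>\<^sub>0 'b::comm_monoid_add"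
  by (rule poly_mapping_eqI) (auto simp: lookup_sum lookup_single when_def in_keys_iff sum.delta')

lemma keys_add_nat: "Poly_Mapping.keys (a + b) = Poly_Mapping.keys a \<union> Poly_Mapping.keys b"
  for a b :: "'v \<Rightarrow>\<^sub>0 nat"
  by (auto simp: in_keys_iff lookup_add)

lemma lookup_monomial_mult: "Poly_Mapping.lookup (monomial t * p) (t + m) = Poly_Mapping.lookup p m"
  for p :: "('v, 'k::field) mpoly"
proof -
  have "Poly_Mapping.lookup (monomial t * p) (t + m) = (\<Sum>q. Poly_Mapping.lookup p q when t + m = t + q)"
    by (simp add: monomial_def lookup_mult lookup_single when_mult)
  then show ?thesis by simp
qed

lemma keys_monomial_mult: "Poly_Mapping.keys (monomial t * p) = (+) t ` Poly_Mapping.keys p"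
  for p :: "('v, 'k::field) mpoly"
proof
  show "Poly_Mapping.keys (monomial t * p) \<subseteq> (+) t ` Poly_Mapping.keys p"
    using Poly_Mapping.keys_mult[of "monomial t" p] by (auto simp: monomial_def)
  show "(+) t ` Poly_Mapping.keys p \<subseteq> Poly_Mapping.keys (monomial t * p)"
    by (auto simp: in_keys_iff lookup_monomial_mult)
qed

lemma keys_monomial [simp]: "Poly_Mapping.keys (monomial t :: ('v, 'k::field) mpoly) = {t}"
  by (simp add: monomial_def)

lemma monomial_add: "monomial (s + t) = monomial s * monomial t"
  by (simp add: monomial_def mult_single)

lemma monomial_mem_polys [simp]: "monomial t \<in> polys V \<longleftrightarrow> Poly_Mapping.keys t \<subseteq> V"
  by (simp add: mem_polys_iff)

definition indicator_exponent :: "'v set \<Rightarrow> 'v \<Rightarrow>\<^sub>0 nat" where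
  "indicator_exponent A = (\<Sum>x\<in>A. Poly_Mapping.single x 1)"

definition squarefree_monomial :: "'v set \<Rightarrow> ('v, 'k::field) mpoly" where
  "squarefree_monomial A = monomial (indicator_exponent A)"

lemma lookup_indicator_exponent:
  "finite A \<Longrightarrow> Poly_Mapping.lookup (indicator_exponent A) x = (if x \<in> A then 1 else 0)"
  by (simp add: indicator_exponent_def lookup_sum lookup_single when_def sum.delta')

lemma keys_indicator_exponent [simp]: "finite A \<Longrightarrow> Poly_Mapping.keys (indicator_exponent A) = A"
  by (auto simp: in_keys_iff lookup_indicator_exponent split: if_splits)

lemma variable_eq: "variable x = squarefree_monomial {x}"
  by (simp add: variable_def squarefree_monomial_def indicator_exponent_def)

lemma squarefree_monomial_union:
  "finite A \<Longrightarrow> finite B \<Longrightarrow> A \<inter> B = {} \<Longrightarrow>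
    squarefree_monomial (A \<union> B) = squarefree_monomial A * squarefree_monomial B"
  by (simp add: squarefree_monomial_def indicator_exponent_def sum.union_disjoint monomial_add)

lemma squarefree_monomial_mem_polys [simp]:
  "finite A \<Longrightarrow> A \<subseteq> V \<Longrightarrow> squarefree_monomial A \<in> polys V"
  by (simp add: squarefree_monomial_def)

lemma variable_mem_polys [simp]: "x \<in> V \<Longrightarrow> variable x \<in> polys V"
  by (simp add: variable_eq)


section \<open>Square-free monomial ideals\<close>

text \<open>A square-free monomial ideal is given by the family \<open>Q\<close> of supports of its monomials.\<close>

definition squarefree_ideal :: "'v set \<Rightarrow> ('v set \<Rightarrow> bool) \<Rightarrow> ('v, 'k::field) mpoly set" where
  "squarefree_ideal V Q = {p \<in> polys V. \<forall>m\<in>Poly_Mapping.keys p. Q (Poly_Mapping.keys m)}"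

definition upward_closed :: "'v set \<Rightarrow> ('v set \<Rightarrow> bool) \<Rightarrow> bool" where
  "upward_closed V Q \<longleftrightarrow> (\<forall>S T. S \<subseteq> T \<and> T \<subseteq> V \<and> Q S \<longrightarrow> Q T)"

lemma squarefree_ideal_cong:
  "(\<And>S. S \<subseteq> V \<Longrightarrow> Q S \<longleftrightarrow> Q' S) \<Longrightarrow> squarefree_ideal V Q = squarefree_ideal V Q'"
  by (auto simp: squarefree_ideal_def mem_polys_iff)

lemma squarefree_ideal_True: "(\<And>S. S \<subseteq> V \<Longrightarrow> Q S) \<Longrightarrow> squarefree_ideal V Q = polys V"
  using squarefree_ideal_cong[of V Q "\<lambda>S. True"] by (simp add: squarefree_ideal_def)

lemma monomial_mem_squarefree_ideal:
  "monomial t \<in> squarefree_ideal V Q \<longleftrightarrow> Poly_Mapping.keys t \<subseteq> V \<and> Q (Poly_Mapping.keys t)"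
  by (auto simp: squarefree_ideal_def)

lemma squarefree_monomial_mem_squarefree_ideal:
  "finite A \<Longrightarrow> squarefree_monomial A \<in> squarefree_ideal V Q \<longleftrightarrow> A \<subseteq> V \<and> Q A"
  by (simp add: squarefree_monomial_def monomial_mem_squarefree_ideal)

lemma is_ideal_squarefree_ideal:
  fixes Q :: "'v set \<Rightarrow> bool"
  assumes Q: "upward_closed V Q"
  shows "polys.is_ideal V (squarefree_ideal V Q :: ('v, 'k::field) mpoly set)"
  unfolding polys.is_ideal_def
proof (intro conjI ballI)
  fix p q :: "('v, 'k) mpoly"
  show "squarefree_ideal V Q \<subseteq> (polys V :: ('v, 'k) mpoly set)" "(0 :: ('v, 'k) mpoly) \<in> squarefree_ideal V Q"
    by (auto simp: squarefree_ideal_def)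
  assume q: "q \<in> squarefree_ideal V Q"
  show "p + q \<in> squarefree_ideal V Q" if "p \<in> squarefree_ideal V Q"
    using that q Poly_Mapping.keys_add[of p q] by (auto simp: squarefree_ideal_def)
  show "p * q \<in> squarefree_ideal V Q" if p: "p \<in> polys V"
    unfolding squarefree_ideal_def
  proof (intro CollectI conjI ballI)
    show pq: "p * q \<in> polys V" using p q by (simp add: squarefree_ideal_def)
    fix m assume m: "m \<in> Poly_Mapping.keys (p * q)"
    then obtain a b where ab: "m = a + b" "b \<in> Poly_Mapping.keys q"
      using Poly_Mapping.keys_mult[of p q] by blast
    have "Poly_Mapping.keys m \<subseteq> V" using m pq by (simp add: mem_polys_iff)
    moreover have "Q (Poly_Mapping.keys b)" using q ab by (simp add: squarefree_ideal_def)
    moreover have "Poly_Mapping.keys b \<subseteq> Poly_Mapping.keys m" using ab by (simp add: keys_add_nat)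
    ultimately show "Q (Poly_Mapping.keys m)" using Q unfolding upward_closed_def by blast
  qed
qed

text \<open>Multiplication by a monomial only shifts exponents, so no terms cancel. With
  \<open>adjoin_squarefree_ideal\<close> it turns splitting along a variable into an operation on
  \<open>Q\<close>: inverting \<open>x\<close> adds it to the argument, killing \<open>x\<close>
  adds a disjunct.\<close>

lemma colon_squarefree_ideal:
  fixes Q :: "'v set \<Rightarrow> bool"
  assumes "finite A" "A \<subseteq> V"
  shows "polys.colon V (squarefree_ideal V Q :: ('v, 'k::field) mpoly set) (squarefree_monomial A)
    = squarefree_ideal V (\<lambda>S. Q (S \<union> A))"
proof -
  have "squarefree_monomial A * p \<in> squarefree_ideal V Q \<longleftrightarrow> p \<in> squarefree_ideal V (\<lambda>S. Q (S \<union> A))"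
    if "p \<in> polys V" for p :: "('v, 'k) mpoly"
    using that assms
    by (simp add: squarefree_ideal_def squarefree_monomial_def keys_monomial_mult keys_add_nat Un_commute)
  then show ?thesis by (auto simp: polys.colon_def) (auto simp: squarefree_ideal_def)
qed

lemma single_mem_ideal:
  fixes N :: "('v, 'k::field) mpoly set"
  assumes N: "polys.is_ideal V N" and A: "finite A" "squarefree_monomial A \<in> N"
    and m: "A \<subseteq> Poly_Mapping.keys m" "Poly_Mapping.keys m \<subseteq> V"
  shows "Poly_Mapping.single m c \<in> N"
proof -
  define n where "n = m - indicator_exponent A"
  have mn: "m = n + indicator_exponent A"
  proof (rule poly_mapping_eqI)
    fix x
    have "x \<in> A \<Longrightarrow> Poly_Mapping.lookup m x \<noteq> 0" using m by (auto simp: in_keys_iff)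
    then show "Poly_Mapping.lookup m x = Poly_Mapping.lookup (n + indicator_exponent A) x"
      using A by (auto simp: n_def lookup_add lookup_minus lookup_indicator_exponent)
  qed
  have "Poly_Mapping.single m c = Poly_Mapping.single n c * (squarefree_monomial A :: ('v, 'k) mpoly)"
    by (subst (1) mn) (simp add: squarefree_monomial_def monomial_def mult_single)
  moreover have "Poly_Mapping.single n c \<in> (polys V :: ('v, 'k) mpoly set)"
    using m unfolding mn keys_add_nat by (auto simp: mem_polys_iff)
  ultimately show ?thesis using polys.is_ideal_mult[OF N _ A(2)] by metis
qed

text \<open>It suffices to treat single terms, and a term is a multiple of every square-free
  monomial whose support it contains.\<close>

lemma squarefree_ideal_subset:
  fixes N :: "('v, 'k::field) mpoly set"
  assumes N: "polys.is_ideal V N"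
    and gens: "\<And>S. finite S \<Longrightarrow> S \<subseteq> V \<Longrightarrow> Q S \<Longrightarrow> \<exists>A\<subseteq>S. squarefree_monomial A \<in> N"
  shows "squarefree_ideal V Q \<subseteq> N"
proof
  fix p :: "('v, 'k) mpoly" assume p: "p \<in> squarefree_ideal V Q"
  have "(\<Sum>m\<in>Poly_Mapping.keys p. Poly_Mapping.single m (Poly_Mapping.lookup p m)) \<in> N"
  proof (rule polys.is_ideal_sum[OF N])
    fix m assume "m \<in> Poly_Mapping.keys p"
    then have m: "Poly_Mapping.keys m \<subseteq> V" "Q (Poly_Mapping.keys m)"
      using p by (auto simp: squarefree_ideal_def mem_polys_iff)
    with gens[of "Poly_Mapping.keys m"] obtain A
      where A: "A \<subseteq> Poly_Mapping.keys m" "squarefree_monomial A \<in> N"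
      by auto
    then show "Poly_Mapping.single m (Poly_Mapping.lookup p m) \<in> N"
      using finite_subset[OF A(1)] m by (intro single_mem_ideal[OF N]) auto
  qed
  then show "p \<in> N" by (simp flip: sum_monomials)
qed

lemma adjoin_squarefree_ideal:
  fixes Q :: "'v set \<Rightarrow> bool"
  assumes Q: "upward_closed V Q" and A: "finite A" "A \<subseteq> V"
  shows "polys.adjoin V (squarefree_ideal V Q :: ('v, 'k::field) mpoly set) (squarefree_monomial A)
    = squarefree_ideal V (\<lambda>S. Q S \<or> A \<subseteq> S)"
    (is "?L = ?R")
proof
  have up: "upward_closed V (\<lambda>S. Q S \<or> A \<subseteq> S)"
    using Q unfolding upward_closed_def by blast
  have xA: "squarefree_monomial A \<in> (polys V :: ('v, 'k) mpoly set)" using A by simp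
  show "?L \<subseteq> ?R"
  proof (rule polys.adjoin_least[OF is_ideal_squarefree_ideal[OF up]])
    show "squarefree_monomial A \<in> ?R" using A by (simp add: squarefree_monomial_mem_squarefree_ideal)
  qed (auto simp: squarefree_ideal_def)
  have ideal: "polys.is_ideal V (squarefree_ideal V Q :: ('v, 'k) mpoly set)"
    by (rule is_ideal_squarefree_ideal[OF Q])
  show "?R \<subseteq> ?L"
  proof (rule squarefree_ideal_subset[OF polys.is_ideal_adjoin[OF ideal xA]])
    fix S assume S: "finite S" "S \<subseteq> V" "Q S \<or> A \<subseteq> S"
    have "squarefree_monomial S \<in> ?L" if "Q S"
      using that S by (intro polys.subset_adjoin) (simp add: squarefree_monomial_mem_squarefree_ideal)
    then show "\<exists>B\<subseteq>S. squarefree_monomial B \<in> ?L"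
      using S polys.self_mem_adjoin[OF ideal] by blast
  qed
qed


section \<open>Homogeneous ideals\<close>

text \<open>The counted variables are a parameter: all variables of the ring give the usual grading,
  while a parity class of vertices later gives the degree in that class alone.\<close>

definition total_degree :: "'v set \<Rightarrow> ('v \<Rightarrow>\<^sub>0 nat) \<Rightarrow> nat" where
  "total_degree V m = (\<Sum>x\<in>V. Poly_Mapping.lookup m x)"

definition homogeneous :: "'v set \<Rightarrow> nat \<Rightarrow> ('v, 'k::field) mpoly \<Rightarrow> bool" where
  "homogeneous V d p \<longleftrightarrow> (\<forall>m\<in>Poly_Mapping.keys p. total_degree V m = d)"

definition homogeneous_part :: "'v set \<Rightarrow> nat \<Rightarrow> ('v, 'k::field) mpoly \<Rightarrow> ('v, 'k) mpoly" where
  "homogeneous_part V d p =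
     (\<Sum>m | m \<in> Poly_Mapping.keys p \<and> total_degree V m = d. Poly_Mapping.single m (Poly_Mapping.lookup p m))"

definition homogeneous_ideal :: "'v set \<Rightarrow> ('v, 'k::field) mpoly set \<Rightarrow> bool" where
  "homogeneous_ideal V N \<longleftrightarrow> (\<forall>p\<in>N. \<forall>d. homogeneous_part V d p \<in> N)"

lemma total_degree_add: "total_degree V (a + b) = total_degree V a + total_degree V b"
  by (simp add: total_degree_def lookup_add sum.distrib)

lemma lookup_homogeneous_part:
  "Poly_Mapping.lookup (homogeneous_part V d p) m = (if total_degree V m = d then Poly_Mapping.lookup p m else 0)"
  unfolding homogeneous_part_def
  by (auto simp: lookup_sum lookup_single when_def in_keys_iff sum.delta')

lemma keys_homogeneous_part:
  "Poly_Mapping.keys (homogeneous_part V d p) = {m \<in> Poly_Mapping.keys p. total_degree V m = d}"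
  by (auto simp: in_keys_iff lookup_homogeneous_part split: if_splits)

lemma homogeneous_homogeneous_part: "homogeneous V d (homogeneous_part V d p)"
  by (simp add: homogeneous_def keys_homogeneous_part)

lemma homogeneous_part_mem_polys: "p \<in> polys V \<Longrightarrow> homogeneous_part V d p \<in> polys V"
  by (simp add: mem_polys_iff keys_homogeneous_part)

lemma homogeneous_part_add:
  "homogeneous_part V d (p + q) = homogeneous_part V d p + homogeneous_part V d q"
  by (rule poly_mapping_eqI) (simp add: lookup_homogeneous_part lookup_add)

lemma homogeneous_part_same: "homogeneous V d p \<Longrightarrow> homogeneous_part V d p = p"
  by (rule poly_mapping_eqI) (auto simp: lookup_homogeneous_part homogeneous_def in_keys_iff)

lemma homogeneous_part_zero:
  "(\<And>m. m \<in> Poly_Mapping.keys p \<Longrightarrow> total_degree V m \<noteq> d) \<Longrightarrow> homogeneous_part V d p = 0"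
  by (rule poly_mapping_eqI) (auto simp: lookup_homogeneous_part in_keys_iff)

lemma homogeneous_mult: "homogeneous V d p \<Longrightarrow> homogeneous V e q \<Longrightarrow> homogeneous V (d + e) (p * q)"
  using Poly_Mapping.keys_mult[of p q] by (fastforce simp: homogeneous_def total_degree_add)

lemma homogeneous_part_mult:
  assumes f: "homogeneous V e f"
  shows "homogeneous_part V (e + d) (f * p) = f * homogeneous_part V d p"
proof -
  let ?q = "p - homogeneous_part V d p"
  have q: "total_degree V m \<noteq> d" if "m \<in> Poly_Mapping.keys ?q" for m
    using that by (auto simp: in_keys_iff lookup_minus lookup_homogeneous_part)
  have "homogeneous_part V (e + d) (f * ?q) = 0"
  proof (rule homogeneous_part_zero)
    fix m assume "m \<in> Poly_Mapping.keys (f * ?q)"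
    then obtain a b where "m = a + b" "a \<in> Poly_Mapping.keys f" "b \<in> Poly_Mapping.keys ?q"
      using Poly_Mapping.keys_mult[of f ?q] by blast
    then show "total_degree V m \<noteq> e + d" using f q by (auto simp: homogeneous_def total_degree_add)
  qed
  moreover have "homogeneous_part V (e + d) (f * homogeneous_part V d p) = f * homogeneous_part V d p"
    by (intro homogeneous_part_same homogeneous_mult f homogeneous_homogeneous_part)
  ultimately show ?thesis
    using homogeneous_part_add[of V "e + d" "f * homogeneous_part V d p" "f * ?q"]
    by (simp add: algebra_simps)
qed

lemma homogeneous_part_mult_less:
  assumes f: "homogeneous V e f" and "d < e"
  shows "homogeneous_part V d (f * p) = 0"
proof (rule homogeneous_part_zero)
  fix m assume "m \<in> Poly_Mapping.keys (f * p)"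
  then obtain a b where "m = a + b" "a \<in> Poly_Mapping.keys f"
    using Poly_Mapping.keys_mult[of f p] by blast
  then show "total_degree V m \<noteq> d" using f \<open>d < e\<close> by (auto simp: homogeneous_def total_degree_add)
qed

lemma sum_homogeneous_parts:
  "p = (\<Sum>d\<in>total_degree V ` Poly_Mapping.keys p. homogeneous_part V d p)"
proof (rule poly_mapping_eqI)
  fix m
  show "Poly_Mapping.lookup p m = Poly_Mapping.lookup (\<Sum>d\<in>total_degree V ` Poly_Mapping.keys p. homogeneous_part V d p) m"
  proof (cases "m \<in> Poly_Mapping.keys p")
    case True
    then show ?thesis by (simp add: lookup_sum lookup_homogeneous_part sum.delta)
  next
    case False
    then have "Poly_Mapping.lookup p m = 0" by (simp add: in_keys_iff)
    then show ?thesis by (simp add: lookup_sum lookup_homogeneous_part)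
  qed
qed

lemma homogeneous_squarefree_ideal: "homogeneous_ideal V (squarefree_ideal V Q)"
  by (auto simp: homogeneous_ideal_def squarefree_ideal_def homogeneous_part_mem_polys keys_homogeneous_part)

lemma homogeneous_squarefree_monomial:
  "finite V \<Longrightarrow> A \<subseteq> V \<Longrightarrow> homogeneous V (card A) (squarefree_monomial A)"
  using finite_subset[of A V]
  by (simp add: homogeneous_def squarefree_monomial_def total_degree_def lookup_indicator_exponent
      Int_absorb1 flip: sum.inter_restrict)

lemma homogeneous_ideal_adjoin:
  fixes N :: "('v, 'k::field) mpoly set"
  assumes N: "polys.is_ideal V N" "homogeneous_ideal V N" and f: "homogeneous V e f"
  shows "homogeneous_ideal V (polys.adjoin V N f)"
  unfolding homogeneous_ideal_def
proof (intro ballI allI)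
  fix p d assume "p \<in> polys.adjoin V N f"
  then obtain a r where ar: "a \<in> N" "r \<in> polys V" "p = a + f * r" by (rule polys.adjoinE)
  have a: "homogeneous_part V d a \<in> N" using N ar by (simp add: homogeneous_ideal_def)
  show "homogeneous_part V d p \<in> polys.adjoin V N f"
  proof (cases "d < e")
    case True
    then show ?thesis
      using a by (simp add: ar homogeneous_part_add homogeneous_part_mult_less[OF f] polys.subset_adjoin)
  next
    case False
    then have "homogeneous_part V d (f * r) = f * homogeneous_part V (d - e) r"
      using homogeneous_part_mult[OF f, of "d - e" r] by simp
    then show ?thesis
      using polys.adjoinI[OF a homogeneous_part_mem_polys[OF ar(2)], of f "d - e"]
      by (simp add: ar homogeneous_part_add)
  qed
qed

text \<open>Graded Nakayama in disguise: an element of \<open>N\<close> plus a multiple of \<open>x\<close> is divided by \<open>x\<close>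
  repeatedly, each step lowering the degree.\<close>

lemma nonzerodivisor_mod_of_adjoin:
  fixes N :: "('v, 'k::field) mpoly set"
  assumes N: "polys.is_ideal V N" "homogeneous_ideal V N"
    and x: "x \<in> polys V" "homogeneous V 1 x" "polys.nonzerodivisor_mod V N x"
    and f: "f \<in> polys V" "homogeneous V e f" "polys.nonzerodivisor_mod V (polys.adjoin V N x) f"
  shows "polys.nonzerodivisor_mod V N f"
proof -
  have hom: "u \<in> N" if "u \<in> polys V" "homogeneous V d u" "f * u \<in> N" for d u
    using that
  proof (induction d arbitrary: u rule: less_induct)
    case (less d)
    have "u \<in> polys.adjoin V N x"
      using polys.nonzerodivisor_modD[OF f(3)] less.prems polys.subset_adjoin by blast
    then obtain a r where ar: "a \<in> N" "r \<in> polys V" "u = a + x * r" by (rule polys.adjoinE)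
    have a: "homogeneous_part V d a \<in> N" using N ar by (simp add: homogeneous_ideal_def)
    have u: "u = homogeneous_part V d a + homogeneous_part V d (x * r)"
      using homogeneous_part_same[OF less.prems(2)] ar(3) by (simp add: homogeneous_part_add)
    show ?case
    proof (cases d)
      case 0
      then show ?thesis using u a homogeneous_part_mult_less[OF x(2), of 0 r] by simp
    next
      case (Suc d')
      define r' where "r' = homogeneous_part V d' r"
      have r': "r' \<in> polys V" "homogeneous V d' r'"
        using ar by (simp_all add: r'_def homogeneous_part_mem_polys homogeneous_homogeneous_part)
      have u': "u = homogeneous_part V d a + x * r'"
        using u homogeneous_part_mult[OF x(2), of d' r] Suc by (simp add: r'_def)
      have "x * (f * r') = f * u - f * homogeneous_part V d a"
        by (simp add: u' algebra_simps)
      also have "\<dots> \<in> N"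
        using less.prems(3) a f(1) N(1) polys.is_ideal_diff polys.is_ideal_mult by blast
      finally have "f * r' \<in> N"
        using polys.nonzerodivisor_modD[OF x(3)] f(1) r' by simp
      then have "r' \<in> N" using less.IH[of d'] r' Suc by simp
      then show ?thesis
        using u' a x(1) N(1) polys.is_ideal_add polys.is_ideal_mult by metis
    qed
  qed
  show ?thesis
    unfolding polys.nonzerodivisor_mod_def
  proof (intro ballI impI)
    fix u assume u: "u \<in> polys V" "f * u \<in> N"
    have "homogeneous_part V d u \<in> N" for d
    proof (rule hom[where d = d])
      show "f * homogeneous_part V d u \<in> N"
        using u(2) N(2) homogeneous_part_mult[OF f(2), of d u] by (metis homogeneous_ideal_def)
    qed (simp_all add: u homogeneous_part_mem_polys homogeneous_homogeneous_part)
    then have "(\<Sum>d\<in>total_degree V ` Poly_Mapping.keys u. homogeneous_part V d u) \<in> N"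
      by (intro polys.is_ideal_sum[OF N(1)])
    then show "u \<in> N" by (simp flip: sum_homogeneous_parts)
  qed
qed

text \<open>Neighbours in the sequence may be exchanged, so \<open>x\<close> moves to the end and
  disappears there. Homogeneity is what makes \<open>f\<close> regular before \<open>x\<close> has
  been factored out; that \<open>x\<close> stays regular modulo \<open>f\<close> is pure
  exchange.\<close>

lemma weakly_regular_drop:
  fixes N :: "('v, 'k::field) mpoly set"
  assumes "polys.is_ideal V N" "homogeneous_ideal V N"
    and "x \<in> polys V" "homogeneous V 1 x"
    and "\<And>f. f \<in> set fs \<Longrightarrow> f \<in> polys V \<and> (\<exists>e. homogeneous V e f)"
    and "polys.weakly_regular V N (x # fs)"
  shows "polys.weakly_regular V N fs"
  using assms
proof (induction fs arbitrary: N)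
  case (Cons f fs)
  note N = Cons.prems(1,2) and x = Cons.prems(3,4)
  obtain e where f: "f \<in> polys V" "homogeneous V e f" using Cons.prems(5) by fastforce
  have nx: "polys.nonzerodivisor_mod V N x" and nf: "polys.nonzerodivisor_mod V (polys.adjoin V N x) f"
    and reg: "polys.weakly_regular V (polys.adjoin V (polys.adjoin V N x) f) fs"
    using Cons.prems(6) by auto
  have "polys.nonzerodivisor_mod V (polys.adjoin V N f) x"
    unfolding polys.nonzerodivisor_mod_def
  proof (intro ballI impI)
    fix u assume u: "u \<in> polys V" "x * u \<in> polys.adjoin V N f"
    from u(2) obtain a v where av: "a \<in> N" "v \<in> polys V" "x * u = a + f * v" by (rule polys.adjoinE)
    have "f * v = - a + x * u" using av by simp
    then have "f * v \<in> polys.adjoin V N x"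
      using polys.adjoinI[OF polys.is_ideal_uminus[OF N(1) av(1)] u(1)] by simp
    then have "v \<in> polys.adjoin V N x" using polys.nonzerodivisor_modD[OF nf] av by blast
    then obtain b w where bw: "b \<in> N" "w \<in> polys V" "v = b + x * w" by (rule polys.adjoinE)
    have "x * (u - f * w) = a + f * b" using av bw by (simp add: algebra_simps)
    also have "\<dots> \<in> N"
      using av bw f(1) N(1) polys.is_ideal_add polys.is_ideal_mult by blast
    finally have "u - f * w \<in> N"
      using polys.nonzerodivisor_modD[OF nx] u bw f by simp
    from polys.adjoinI[OF this bw(2), of f] show "u \<in> polys.adjoin V N f" by simp
  qed
  moreover have "polys.adjoin V (polys.adjoin V N f) x = polys.adjoin V (polys.adjoin V N x) f"
    by (rule polys.adjoin_commute) (use N x f in auto)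
  ultimately have "polys.weakly_regular V (polys.adjoin V N f) fs"
    using N x f reg Cons.prems(5)
    by (intro Cons.IH) (auto simp: polys.is_ideal_adjoin homogeneous_ideal_adjoin)
  then show ?case
    using nonzerodivisor_mod_of_adjoin[OF N x nx f nf] by simp
qed simp

section \<open>Elementary symmetric polynomials\<close>

definition elementary :: "'v set \<Rightarrow> nat \<Rightarrow> ('v, 'k::field) mpoly" where
  "elementary V d = (\<Sum>A | A \<subseteq> V \<and> card A = d. squarefree_monomial A)"

text \<open>The order is descending because the entry treated first has to be the one of top degree
  in the free variables.\<close>

fun elementaries :: "'v set \<Rightarrow> nat \<Rightarrow> ('v, 'k::field) mpoly list" where
  "elementaries V 0 = []"
| "elementaries V (Suc d) = elementary V (Suc d) # elementaries V d"

lemma length_elementaries [simp]: "length (elementaries V d) = d"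
  by (induction d) auto

lemma set_elementaries: "set (elementaries V d) = elementary V ` {1..d}"
  by (induction d) (auto simp: atLeastAtMostSuc_conv)

lemma elementary_mem_polys: "finite V \<Longrightarrow> elementary V d \<in> polys V"
  unfolding elementary_def by (intro polys.sum_mem squarefree_monomial_mem_polys) (auto dest: finite_subset)

lemma homogeneous_sum: "(\<And>i. i \<in> I \<Longrightarrow> homogeneous V d (f i)) \<Longrightarrow> homogeneous V d (\<Sum>i\<in>I. f i)"
  using Poly_Mapping.keys_add
  by (induction I rule: infinite_finite_induct) (fastforce simp: homogeneous_def)+

lemma homogeneous_elementary: "finite V \<Longrightarrow> homogeneous V d (elementary V d)"
  unfolding elementary_def
  by (intro homogeneous_sum) (auto dest: homogeneous_squarefree_monomial)

lemma elementaries_properties: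
  "finite V \<Longrightarrow> f \<in> set (elementaries V d) \<Longrightarrow> f \<in> polys V \<and> (\<exists>e. homogeneous V e f)"
  by (auto simp: set_elementaries elementary_mem_polys intro: homogeneous_elementary)

lemma set_elementaries_subset: "finite V \<Longrightarrow> set (elementaries V d) \<subseteq> polys V"
  using elementaries_properties by blast

abbreviation meets :: "'v set \<Rightarrow> 'v set \<Rightarrow> bool" where
  "meets P S \<equiv> S \<inter> P \<noteq> {}"

lemma upward_closed_meets: "upward_closed V (meets P)"
  unfolding upward_closed_def by blast

lemma nonzerodivisor_mod_meets:
  assumes "finite A" "A \<subseteq> V - P"
  shows "polys.nonzerodivisor_mod V (squarefree_ideal V (meets P)) (squarefree_monomial A)"
proof -
  have "polys.colon V (squarefree_ideal V (meets P)) (squarefree_monomial A) = squarefree_ideal V (meets P)"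
    using assms by (subst colon_squarefree_ideal) (auto intro!: squarefree_ideal_cong)
  then show ?thesis by (auto simp: polys.nonzerodivisor_mod_def polys.colon_def)
qed

text \<open>Modulo the variables in \<open>P\<close>, only the top monomial in the remaining variables survives.\<close>

lemma elementary_cong_top:
  assumes V: "finite V" and d: "card (V - P) = d"
  shows "elementary V d - squarefree_monomial (V - P)
    \<in> (squarefree_ideal V (meets P) :: ('v, 'k::field) mpoly set)"
proof -
  have "(elementary V d :: ('v, 'k) mpoly) = squarefree_monomial (V - P)
      + (\<Sum>A\<in>{A. A \<subseteq> V \<and> card A = d} - {V - P}. squarefree_monomial A)"
    unfolding elementary_def using V d by (intro sum.remove) auto
  moreover have "(\<Sum>A\<in>{A. A \<subseteq> V \<and> card A = d} - {V - P}. squarefree_monomial A)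
      \<in> (squarefree_ideal V (meets P) :: ('v, 'k) mpoly set)"
  proof (rule polys.is_ideal_sum[OF is_ideal_squarefree_ideal[OF upward_closed_meets]])
    fix A assume A: "A \<in> {A. A \<subseteq> V \<and> card A = d} - {V - P}"
    have "A \<inter> P \<noteq> {}"
    proof
      assume "A \<inter> P = {}"
      then have "A \<subseteq> V - P" using A by auto
      then have "A = V - P" using A V d by (intro card_subset_eq) auto
      then show False using A by simp
    qed
    then show "squarefree_monomial A \<in> (squarefree_ideal V (meets P) :: ('v, 'k) mpoly set)"
      using A V finite_subset[of A V] by (auto simp: squarefree_monomial_mem_squarefree_ideal)
  qed
  ultimately show ?thesis by simp
qed

text \<open>The ideal is generated by the variables in \<open>P\<close> and the product of those in
  \<open>A\<close>. Colon by \<open>x\<close> shortens the product, adjoining \<open>x\<close>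
  absorbs it into the variables; the empty product is 1 and leaves the zero module.\<close>

lemma weakly_regular_meets_or_contains:
  fixes fs :: "('v, 'k::field) mpoly list"
  assumes V: "finite V" and A: "finite A" "A \<subseteq> V - P"
    and reg: "\<And>x. x \<in> A \<Longrightarrow> polys.weakly_regular V (squarefree_ideal V (meets (insert x P))) fs"
    and fs: "set fs \<subseteq> polys V"
  shows "polys.weakly_regular V (squarefree_ideal V (\<lambda>S. meets P S \<or> A \<subseteq> S)) fs"
  using A reg
proof (induction A rule: finite_induct)
  case empty
  then show ?case using fs by (simp add: squarefree_ideal_True polys.weakly_regular_carrier)
next
  case (insert x A)
  let ?N = "squarefree_ideal V (\<lambda>S. meets P S \<or> insert x A \<subseteq> S) :: ('v, 'k) mpoly set"
  have up: "upward_closed V (\<lambda>S. meets P S \<or> insert x A \<subseteq> S)"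
    unfolding upward_closed_def by blast
  have x: "finite {x}" "{x} \<subseteq> V" using insert.prems by auto
  show ?case
  proof (rule polys.weakly_regular_exact)
    show "polys.is_ideal V ?N" by (rule is_ideal_squarefree_ideal[OF up])
    show "squarefree_monomial {x} \<in> polys V" using x by simp
    have "polys.colon V ?N (squarefree_monomial {x}) = squarefree_ideal V (\<lambda>S. meets P S \<or> A \<subseteq> S)"
      unfolding colon_squarefree_ideal[OF x] using insert.prems insert.hyps
      by (intro squarefree_ideal_cong) auto
    then show "polys.weakly_regular V (polys.colon V ?N (squarefree_monomial {x})) fs"
      using insert.IH insert.prems by simp
    have "polys.adjoin V ?N (squarefree_monomial {x}) = squarefree_ideal V (meets (insert x P))"
      unfolding adjoin_squarefree_ideal[OF up x] by (intro squarefree_ideal_cong) auto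
    then show "polys.weakly_regular V (polys.adjoin V ?N (squarefree_monomial {x})) fs"
      using insert.prems by simp
  qed (rule fs)
qed

theorem weakly_regular_elementaries:
  assumes V: "finite V" and P: "P \<subseteq> V" "d \<le> card (V - P)"
  shows "polys.weakly_regular V (squarefree_ideal V (meets P)) (elementaries V d :: ('v, 'k::field) mpoly list)"
  using P
proof (induction d arbitrary: P)
  case (Suc d)
  note ideal = is_ideal_squarefree_ideal[OF upward_closed_meets, of V]
  show ?case
    using Suc.prems
  \<comment> \<open>The inner induction is on the number of surplus variables. The subtraction does
    not truncate, so the value 0 means that exactly \<open>Suc d\<close> variables are free.\<close>
  proof (induction "card (V - P) - Suc d" arbitrary: P)
    case 0
    let ?N = "squarefree_ideal V (meets P) :: ('v, 'k) mpoly set"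
    let ?g = "squarefree_monomial (V - P) :: ('v, 'k) mpoly"
    have "P \<subseteq> V" by (rule 0)
    have "card (V - P) = Suc d" using 0 by simp
    note cong = elementary_cong_top[OF V this]
    have g: "?g \<in> polys V" using V by simp
    have "polys.nonzerodivisor_mod V ?N (elementary V (Suc d))"
      using nonzerodivisor_mod_meets[of "V - P" V P] V
      by (subst polys.nonzerodivisor_mod_cong[OF ideal cong]) auto
    moreover have "polys.adjoin V ?N (elementary V (Suc d)) = squarefree_ideal V (\<lambda>S. meets P S \<or> V - P \<subseteq> S)"
      unfolding polys.adjoin_cong[OF ideal elementary_mem_polys[OF V] g cong]
      using V by (intro adjoin_squarefree_ideal upward_closed_meets) auto
    moreover have "polys.weakly_regular V (squarefree_ideal V (\<lambda>S. meets P S \<or> V - P \<subseteq> S))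
        (elementaries V d :: ('v, 'k) mpoly list)"
    proof (rule weakly_regular_meets_or_contains[OF V _ subset_refl])
      fix x assume x: "x \<in> V - P"
      then have "V - P = insert x (V - insert x P)" by blast
      then have "card (V - P) = Suc (card (V - insert x P))"
        using V by (metis card_insert_disjoint finite_Diff Diff_iff insertI1)
      then have "d \<le> card (V - insert x P)" using \<open>card (V - P) = Suc d\<close> by linarith
      moreover have "insert x P \<subseteq> V" using x \<open>P \<subseteq> V\<close> by blast
      ultimately show "polys.weakly_regular V (squarefree_ideal V (meets (insert x P)))
          (elementaries V d :: ('v, 'k) mpoly list)"
        by (intro Suc.IH)
    qed (use V set_elementaries_subset[OF V] in auto)
    ultimately show ?case by (simp only: elementaries.simps polys.weakly_regular.simps)
  next
    case (Suc k)
    let ?N = "squarefree_ideal V (meets P) :: ('v, 'k) mpoly set"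
    have card: "card (V - P) = Suc (Suc (d + k))" using Suc.hyps(2) by simp
    then have "V - P \<noteq> {}" by force
    then obtain x where x: "x \<in> V" "x \<notin> P" by auto
    have "V - P = insert x (V - insert x P)" using x by auto
    then have "card (V - P) = Suc (card (V - insert x P))"
      using V by (metis card_insert_disjoint finite_Diff Diff_iff insertI1)
    then have IH: "polys.weakly_regular V (squarefree_ideal V (meets (insert x P)) :: ('v, 'k) mpoly set)
        (elementaries V (Suc d))"
      using x card Suc.prems by (intro Suc.hyps(1)) auto
    have "polys.adjoin V ?N (squarefree_monomial {x}) = squarefree_ideal V (\<lambda>S. meets P S \<or> {x} \<subseteq> S)"
      using x by (intro adjoin_squarefree_ideal upward_closed_meets) auto
    also have "\<dots> = squarefree_ideal V (meets (insert x P))"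
      by (intro squarefree_ideal_cong) auto
    \<comment> \<open>A surplus variable is regular modulo \<open>P\<close>, and factoring it out
      leads to the inner hypothesis for \<open>insert x P\<close>. So the list is first shown
      regular with \<open>x\<close> in front.\<close>
    finally have reg: "polys.weakly_regular V ?N (squarefree_monomial {x} # elementaries V (Suc d))"
      using IH nonzerodivisor_mod_meets[of "{x}" V P] x by simp
    have hom: "homogeneous V 1 (squarefree_monomial {x} :: ('v, 'k) mpoly)"
      using homogeneous_squarefree_monomial[of V "{x}"] V x by simp
    have mem: "squarefree_monomial {x} \<in> (polys V :: ('v, 'k) mpoly set)" using x by simp
    show ?case
      by (rule weakly_regular_drop[OF ideal homogeneous_squarefree_ideal mem hom _ reg])
        (rule elementaries_properties[OF V])
  qed
qed simp

section \<open>Ideals of supports missing at most one vertex of each colour\<close>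

text \<open>The third set may be smaller than the set of all variables: during the induction it
  holds only the killed and the undecided vertices, since inverted ones can no longer be
  missing.\<close>

definition misses_few :: "'v set \<Rightarrow> 'v set \<Rightarrow> 'v set \<Rightarrow> 'v set \<Rightarrow> bool" where
  "misses_few A B V S \<longleftrightarrow> card ((V - S) \<inter> A) \<le> 1 \<and> card ((V - S) \<inter> B) \<le> 1"

lemma upward_closed_misses_few:
  assumes "finite U"
  shows "upward_closed V (misses_few A B U)"
  unfolding upward_closed_def
proof (intro allI impI, elim conjE)
  fix S T :: "'a set" assume "S \<subseteq> T" "misses_few A B U S"
  moreover have "card ((U - T) \<inter> W) \<le> card ((U - S) \<inter> W)" for W
    using assms \<open>S \<subseteq> T\<close> by (intro card_mono) auto
  ultimately show "misses_few A B U T"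
    unfolding misses_few_def by (meson order_trans)
qed

lemma upward_closed_disj:
  "upward_closed V Q \<Longrightarrow> upward_closed V Q' \<Longrightarrow> upward_closed V (\<lambda>S. Q S \<or> Q' S)"
  unfolding upward_closed_def by metis

text \<open>In the induction the vertices outside \<open>T\<close> have been decided: those in \<open>P\<close> are killed,
  hence missing, and the others are inverted, hence present.\<close>

lemma weakly_regular_misses_few_aux:
  fixes fs :: "('v, 'k::field) mpoly list"
  assumes V: "finite V" and T: "T \<subseteq> V" "P \<subseteq> V" "P \<inter> T = {}" "card P \<le> 3"
    and fs: "set fs \<subseteq> polys V"
    and prime: "\<And>P. P \<subseteq> V \<Longrightarrow> card P \<le> 3 \<Longrightarrow> polys.weakly_regular V (squarefree_ideal V (meets P)) fs"
    and AB: "V \<subseteq> A \<union> B"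
  shows "polys.weakly_regular V (squarefree_ideal V (\<lambda>S. meets P S \<or> misses_few A B (P \<union> T) S)) fs"
proof -
  have "finite T" using V T finite_subset by blast
  then show ?thesis
    using T
  proof (induction T arbitrary: P rule: finite_induct)
    case empty
    have finP: "finite P" using empty.prems V finite_subset by blast
    show ?case
    proof (cases "card (P \<inter> A) \<le> 1 \<and> card (P \<inter> B) \<le> 1")
      case True
      have "misses_few A B P S" for S
      proof -
        have "card ((P - S) \<inter> A) \<le> card (P \<inter> A)" "card ((P - S) \<inter> B) \<le> card (P \<inter> B)"
          using finP by (auto intro!: card_mono)
        then show ?thesis using True by (simp add: misses_few_def)
      qed
      then show ?thesis using fs by (simp add: squarefree_ideal_True polys.weakly_regular_carrier)
    next
      case False
      have "squarefree_ideal V (\<lambda>S. meets P S \<or> misses_few A B (P \<union> {}) S)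
          = (squarefree_ideal V (meets P) :: ('v, 'k) mpoly set)"
      proof (rule squarefree_ideal_cong)
        fix S
        have "\<not> misses_few A B (P \<union> {}) S" if "\<not> meets P S"
        proof -
          have "P - S = P" using that by auto
          then show ?thesis using False by (simp add: misses_few_def)
        qed
        then show "meets P S \<or> misses_few A B (P \<union> {}) S \<longleftrightarrow> meets P S" by auto
      qed
      then show ?thesis using prime[of P] empty.prems by simp
    qed
  next
    case (insert x T)
    have finP: "finite P" using insert.prems V finite_subset by blast
    show ?case
    proof (cases "card (P \<inter> A) \<le> 1 \<and> card (P \<inter> B) \<le> 1")
      case True
      let ?Q = "\<lambda>S. meets P S \<or> misses_few A B (P \<union> insert x T) S"
      have x: "finite {x}" "{x} \<subseteq> V" using insert.prems by auto
      have xP: "x \<notin> P" "x \<notin> T" using insert by auto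
      have up: "upward_closed V ?Q"
        using finP insert.hyps(1)
        by (intro upward_closed_disj upward_closed_meets upward_closed_misses_few) simp
      \<comment> \<open>Source of the bound three: \<open>x\<close> is split off only while
        \<open>P\<close> has at most one vertex of each colour, and the colours cover
        \<open>V\<close>, so \<open>P\<close> has at most two elements before the split.\<close>
      have "card P \<le> card ((P \<inter> A) \<union> (P \<inter> B))"
        using finP AB insert.prems by (intro card_mono) auto
      also have "\<dots> \<le> card (P \<inter> A) + card (P \<inter> B)" by (rule card_Un_le)
      finally have "card P \<le> 2" using True by simp
      then have card: "card (insert x P) \<le> 3" using finP xP by simp
      show ?thesis
      proof (rule polys.weakly_regular_exact)
        show "polys.is_ideal V (squarefree_ideal V ?Q)" by (rule is_ideal_squarefree_ideal[OF up])
        show "squarefree_monomial {x} \<in> polys V" using x by simp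
        have "polys.colon V (squarefree_ideal V ?Q :: ('v, 'k) mpoly set) (squarefree_monomial {x})
            = squarefree_ideal V (\<lambda>S. meets P S \<or> misses_few A B (P \<union> T) S)"
          unfolding colon_squarefree_ideal[OF x]
        proof (rule squarefree_ideal_cong)
          fix S
          have "P \<union> insert x T - (S \<union> {x}) = P \<union> T - S" using xP by auto
          moreover have "(S \<union> {x}) \<inter> P = S \<inter> P" using xP by auto
          ultimately show "meets P (S \<union> {x}) \<or> misses_few A B (P \<union> insert x T) (S \<union> {x})
              \<longleftrightarrow> meets P S \<or> misses_few A B (P \<union> T) S"
            by (simp only: misses_few_def)
        qed
        then show "polys.weakly_regular V (polys.colon V (squarefree_ideal V ?Q) (squarefree_monomial {x})) fs"
          using insert.IH[of P] insert.prems by simp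
        have "polys.adjoin V (squarefree_ideal V ?Q :: ('v, 'k) mpoly set) (squarefree_monomial {x})
            = squarefree_ideal V (\<lambda>S. meets (insert x P) S \<or> misses_few A B (insert x P \<union> T) S)"
          unfolding adjoin_squarefree_ideal[OF up x]
        proof (rule squarefree_ideal_cong)
          fix S
          have "P \<union> insert x T = insert x P \<union> T" by simp
          moreover have "meets (insert x P) S \<longleftrightarrow> meets P S \<or> {x} \<subseteq> S" by auto
          ultimately show "(meets P S \<or> misses_few A B (P \<union> insert x T) S) \<or> {x} \<subseteq> S
              \<longleftrightarrow> meets (insert x P) S \<or> misses_few A B (insert x P \<union> T) S"
            by (simp only: disj_ac)
        qed
        then show "polys.weakly_regular V (polys.adjoin V (squarefree_ideal V ?Q) (squarefree_monomial {x})) fs"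
          using insert.IH[of "insert x P"] insert.prems xP card by simp
      qed (rule fs)
    next
      case False
      \<comment> \<open>Two vertices of one colour are already killed. A support avoiding
        \<open>P\<close> misses both of them, so only the prime ideal of the variables in
        \<open>P\<close> remains and the splitting stops early.\<close>
      have "squarefree_ideal V (\<lambda>S. meets P S \<or> misses_few A B (P \<union> insert x T) S)
          = (squarefree_ideal V (meets P) :: ('v, 'k) mpoly set)"
      proof (rule squarefree_ideal_cong)
        fix S
        have "\<not> misses_few A B (P \<union> insert x T) S" if "\<not> meets P S"
        proof -
          have "card (P \<inter> A) \<le> card ((P \<union> insert x T - S) \<inter> A)"
            "card (P \<inter> B) \<le> card ((P \<union> insert x T - S) \<inter> B)"
            using that finP insert.hyps by (auto intro!: card_mono)
          then show ?thesis using False by (auto simp: misses_few_def)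
        qed
        then show "meets P S \<or> misses_few A B (P \<union> insert x T) S \<longleftrightarrow> meets P S" by auto
      qed
      then show ?thesis using prime[of P] insert.prems by simp
    qed
  qed
qed

theorem weakly_regular_misses_few:
  assumes V: "finite V" and AB: "V \<subseteq> A \<union> B" and d: "d + 3 \<le> card V"
  shows "polys.weakly_regular V (squarefree_ideal V (misses_few A B V))
    (elementaries V d :: ('v, 'k::field) mpoly list)"
proof -
  have "polys.weakly_regular V (squarefree_ideal V (\<lambda>S. meets {} S \<or> misses_few A B ({} \<union> V) S))
      (elementaries V d :: ('v, 'k) mpoly list)"
  proof (rule weakly_regular_misses_few_aux[OF V _ _ _ _ set_elementaries_subset[OF V] _ AB])
    fix P assume P: "P \<subseteq> V" "card P \<le> 3"
    then have "d \<le> card (V - P)"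
      using d V finite_subset[OF P(1) V] by (simp add: card_Diff_subset)
    then show "polys.weakly_regular V (squarefree_ideal V (meets P)) (elementaries V d :: ('v, 'k) mpoly list)"
      using V P by (intro weakly_regular_elementaries)
  qed auto
  then show ?thesis by simp
qed

section \<open>Depth of a quotient of the polynomial ring\<close>

lemma mpoly_ring_simps:
  "carrier (mpoly_ring V) = polys V" "mult (mpoly_ring V) = (*)" "one (mpoly_ring V) = 1"
  "zero (mpoly_ring V) = 0" "add (mpoly_ring V) = (+)"
  by (simp_all add: polys_def mpoly_ring_def)

section \<open>Translation of carrier-based ideals\<close>

lemma ideal_mpoly_ring_iff:
  fixes N :: "('v, 'k::field) mpoly set"
  shows "ideal N (mpoly_ring V) \<longleftrightarrow> polys.is_ideal V N"
proof
  interpret cring "mpoly_ring V :: ('v, 'k) mpoly ring" by (rule cring_mpoly_ring)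
  assume "ideal N (mpoly_ring V)"
  then interpret ideal N "mpoly_ring V" .
  show "polys.is_ideal V N"
    using a_subset zero_closed a_closed I_l_closed
    unfolding polys.is_ideal_def by (simp add: mpoly_ring_simps)
next
  interpret cring "mpoly_ring V :: ('v, 'k) mpoly ring" by (rule cring_mpoly_ring)
  assume N: "polys.is_ideal V N"
  have a_inv: "\<ominus>\<^bsub>mpoly_ring V\<^esub> u = - u" if "u \<in> polys V" for u :: "('v, 'k) mpoly"
    using that by (intro minus_equality) (simp_all add: mpoly_ring_simps)
  show "ideal N (mpoly_ring V)"
  proof (rule idealI)
    show "ring (mpoly_ring V :: ('v, 'k) mpoly ring)" by (rule ring_axioms)
    show "subgroup N (add_monoid (mpoly_ring V))"
    proof (rule add.subgroupI)
      fix u assume "u \<in> N"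
      then show "\<ominus>\<^bsub>mpoly_ring V\<^esub> u \<in> N"
        using a_inv polys.is_ideal_subset[OF N] polys.is_ideal_uminus[OF N] by simp
    qed (use N in \<open>auto simp: mpoly_ring_simps polys.is_ideal_add
        dest: polys.is_ideal_subset polys.is_ideal_zero\<close>)
    show "u \<otimes>\<^bsub>mpoly_ring V\<^esub> r \<in> N" if "u \<in> N" "r \<in> carrier (mpoly_ring V)" for u r
      using polys.is_ideal_mult[OF N, of r u] that by (simp add: mpoly_ring_simps mult.commute)
  qed (use polys.is_ideal_mult[OF N] in \<open>simp add: mpoly_ring_simps\<close>)
qed

lemma genideal_least:
  "polys.is_ideal V N \<Longrightarrow> F \<subseteq> N \<Longrightarrow> Idl\<^bsub>mpoly_ring V\<^esub> F \<subseteq> N"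
  by (auto simp: genideal_def ideal_mpoly_ring_iff)

lemma is_ideal_genideal:
  fixes F :: "('v, 'k::field) mpoly set"
  assumes "F \<subseteq> polys V"
  shows "polys.is_ideal V (Idl\<^bsub>mpoly_ring V\<^esub> F)"
proof -
  interpret cring "mpoly_ring V :: ('v, 'k) mpoly ring" by (rule cring_mpoly_ring)
  show ?thesis using genideal_ideal[of F] assms by (simp add: mpoly_ring_simps ideal_mpoly_ring_iff)
qed

lemma subset_genideal: "F \<subseteq> Idl\<^bsub>mpoly_ring V\<^esub> F"
  by (auto simp: genideal_def)

text \<open>Supplies the coefficients that \<open>weakly_regular_length_le\<close> demands for each
  member of the sequence.\<close>

lemma irrelevant_ideal_sum:
  fixes f :: "('v, 'k::field) mpoly"
  assumes V: "finite V" and f: "f \<in> irrelevant_ideal V"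
  shows "\<exists>g. (\<forall>x\<in>V. g x \<in> polys V) \<and> f = (\<Sum>x\<in>V. variable x * g x)"
proof -
  let ?N = "{f. \<exists>g. (\<forall>x\<in>V. g x \<in> polys V) \<and> f = (\<Sum>x\<in>V. variable x * g x)} :: ('v, 'k) mpoly set"
  have "polys.is_ideal V ?N"
    unfolding polys.is_ideal_def
  proof (intro conjI subsetI ballI)
    show "f \<in> polys V" if "f \<in> ?N" for f using that by (auto intro!: polys.sum_mem)
    show "0 \<in> ?N" by (auto intro!: exI[of _ "\<lambda>x. 0"])
    show "f + f' \<in> ?N" if f: "f \<in> ?N" "f' \<in> ?N" for f f'
    proof -
      from f obtain g g' where "\<forall>x\<in>V. g x \<in> polys V" "f = (\<Sum>x\<in>V. variable x * g x)"
        "\<forall>x\<in>V. g' x \<in> polys V" "f' = (\<Sum>x\<in>V. variable x * g' x)" by auto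
      then show ?thesis
        by (intro CollectI exI[of _ "\<lambda>x. g x + g' x"]) (simp add: distrib_left sum.distrib)
    qed
    show "r * f \<in> ?N" if r: "r \<in> polys V" and f: "f \<in> ?N" for r f
    proof -
      from f obtain g where "\<forall>x\<in>V. g x \<in> polys V" "f = (\<Sum>x\<in>V. variable x * g x)" by auto
      then show ?thesis using r
        by (intro CollectI exI[of _ "\<lambda>x. r * g x"]) (simp add: sum_distrib_left mult.left_commute)
    qed
  qed
  moreover have "variable ` V \<subseteq> ?N"
  proof
    fix f :: "('v, 'k) mpoly" assume "f \<in> variable ` V"
    then obtain x where x: "x \<in> V" "f = variable x" by auto
    have "f = (\<Sum>y\<in>V. if y = x then variable y else 0)" using x V by (simp add: sum.delta')
    also have "\<dots> = (\<Sum>y\<in>V. variable y * (if y = x then 1 else 0))"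
      by (intro sum.cong) auto
    finally show "f \<in> ?N" by (intro CollectI exI[of _ "\<lambda>y. if y = x then 1 else 0"]) auto
  qed
  ultimately have "irrelevant_ideal V \<subseteq> ?N"
    unfolding irrelevant_ideal_def by (rule genideal_least)
  then show ?thesis using f by auto
qed

text \<open>The left side consists of the polynomials without constant term, a form in which
  membership of the elementary symmetric polynomials can be read off.\<close>

lemma irrelevant_ideal_superset:
  "squarefree_ideal V (meets V) \<subseteq> (irrelevant_ideal V :: ('v, 'k::field) mpoly set)"
proof (rule squarefree_ideal_subset)
  show "polys.is_ideal V (irrelevant_ideal V :: ('v, 'k) mpoly set)"
    unfolding irrelevant_ideal_def by (rule is_ideal_genideal) auto
  fix S assume "meets V S"
  then obtain x where "x \<in> S" "x \<in> V" by auto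
  moreover have "variable x \<in> (irrelevant_ideal V :: ('v, 'k) mpoly set)"
    using subset_genideal[of "variable ` V"] \<open>x \<in> V\<close> by (auto simp: irrelevant_ideal_def)
  ultimately show "\<exists>A\<subseteq>S. squarefree_monomial A \<in> (irrelevant_ideal V :: ('v, 'k) mpoly set)"
    by (intro exI[of _ "{x}"]) (simp add: variable_eq)
qed

lemma elementary_mem_squarefree_ideal:
  assumes "finite V" "0 < d"
  shows "elementary V d \<in> (squarefree_ideal V (meets V) :: ('v, 'k::field) mpoly set)"
  unfolding elementary_def
proof (rule polys.is_ideal_sum[OF is_ideal_squarefree_ideal[OF upward_closed_meets]])
  fix A assume A: "A \<in> {A. A \<subseteq> V \<and> card A = d}"
  then have "finite A" "A \<noteq> {}" using assms finite_subset by auto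
  then show "squarefree_monomial A \<in> (squarefree_ideal V (meets V) :: ('v, 'k) mpoly set)"
    using A by (auto simp: squarefree_monomial_mem_squarefree_ideal)
qed

section \<open>Regular sequences on a quotient module, expressed by ideals\<close>

context
  fixes V :: "'v set" and I :: "('v, 'k::field) mpoly set"
  assumes I: "polys.is_ideal V I"
begin

interpretation R: cring "mpoly_ring V :: ('v, 'k) mpoly ring"
  by (rule cring_mpoly_ring)

interpretation ideal I "mpoly_ring V"
  using I by (simp add: ideal_mpoly_ring_iff)

interpretation M: module "mpoly_ring V" "quotient_module (mpoly_ring V) I"
  by (rule module_quotient_module[OF cring_mpoly_ring]) (rule ideal_axioms)

definition coset :: "('v, 'k) mpoly \<Rightarrow> ('v, 'k) mpoly set" where
  "coset u = I +>\<^bsub>mpoly_ring V\<^esub> u"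

lemma quotient_module_simps:
  "carrier (quotient_module (mpoly_ring V) I) = coset ` polys V"
  "zero (quotient_module (mpoly_ring V) I) = coset 0"
  "u \<in> polys V \<Longrightarrow> v \<in> polys V \<Longrightarrow> add (quotient_module (mpoly_ring V) I) (coset u) (coset v) = coset (u + v)"
  "r \<in> polys V \<Longrightarrow> u \<in> polys V \<Longrightarrow> smult (quotient_module (mpoly_ring V) I) r (coset u) = coset (r * u)"
proof -
  have sel: "carrier (quotient_module (mpoly_ring V) I) = carrier (mpoly_ring V Quot I)"
    "add (quotient_module (mpoly_ring V) I) = add (mpoly_ring V Quot I)"
    "zero (quotient_module (mpoly_ring V) I) = zero (mpoly_ring V Quot I)"
    "smult (quotient_module (mpoly_ring V) I) =
      (\<lambda>r u. (I +>\<^bsub>mpoly_ring V\<^esub> r) \<otimes>\<^bsub>mpoly_ring V Quot I\<^esub> u)"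
    by (simp_all add: quotient_module_def ring.defs module.defs)
  show "carrier (quotient_module (mpoly_ring V) I) = coset ` polys V"
    unfolding sel by (auto simp: FactRing_def A_RCOSETS_def' coset_def mpoly_ring_simps)
  have "I = I +>\<^bsub>mpoly_ring V\<^esub> 0"
    using a_rcos_const[of 0] R.zero_closed polys.is_ideal_zero[OF I] by simp
  then show "zero (quotient_module (mpoly_ring V) I) = coset 0"
    unfolding sel by (simp add: FactRing_def coset_def)
  show "add (quotient_module (mpoly_ring V) I) (coset u) (coset v) = coset (u + v)"
    if "u \<in> polys V" "v \<in> polys V"
    unfolding sel coset_def using a_rcos_sum[of u v] that by (simp add: FactRing_def mpoly_ring_simps)
  show "smult (quotient_module (mpoly_ring V) I) r (coset u) = coset (r * u)"
    if "r \<in> polys V" "u \<in> polys V"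
    unfolding sel coset_def using rcoset_mult_add[of r u] that by (simp add: FactRing_def mpoly_ring_simps)
qed

lemma coset_eq_iff: "coset u = coset v \<longleftrightarrow> u - v \<in> I"
proof
  have mem: "w \<in> coset v \<longleftrightarrow> w - v \<in> I" for w v
    by (auto simp: coset_def a_r_coset_def' mpoly_ring_simps intro: bexI[of _ "w - v"])
  show "coset u = coset v \<Longrightarrow> u - v \<in> I"
    using mem[of u u] mem[of u v] polys.is_ideal_zero[OF I] by simp
  assume uv: "u - v \<in> I"
  have "w - u \<in> I \<longleftrightarrow> w - v \<in> I" for w
    using polys.is_ideal_add[OF I _ uv, of "w - u"] polys.is_ideal_diff[OF I _ uv, of "w - v"] by auto
  then show "coset u = coset v" by (auto simp: mem)
qed

text \<open>The cosets of the generated ideal form one of the submodules being intersected.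
  Conversely, the preimage of each such submodule is an ideal containing \<open>I\<close> and
  \<open>fs\<close>, hence contains the generated ideal.\<close>

lemma coset_mem_smult_submodule_iff:
  assumes fs: "set fs \<subseteq> polys V" and u: "u \<in> polys V"
  shows "coset u \<in> smult_submodule (mpoly_ring V) (quotient_module (mpoly_ring V) I) (set fs)
    \<longleftrightarrow> u \<in> foldl (polys.adjoin V) I fs"
proof
  let ?J = "foldl (polys.adjoin V) I fs"
  let ?M = "quotient_module (mpoly_ring V) I"
  have J: "polys.is_ideal V ?J" by (rule polys.is_ideal_foldl_adjoin[OF I fs])
  have JC: "v \<in> polys V" if "v \<in> ?J" for v using polys.is_ideal_subset[OF J that] .
  have IJ: "I \<subseteq> ?J" by (rule polys.subset_foldl_adjoin)
  have neg: "\<ominus>\<^bsub>?M\<^esub> coset v = coset (- v)" if "v \<in> polys V" for v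
    using that by (intro M.minus_equality) (simp_all add: quotient_module_simps)
  have sub: "submodule (coset ` ?J) (mpoly_ring V) ?M"
  proof (rule M.submoduleI)
    show "coset ` ?J \<subseteq> carrier ?M" using JC by (auto simp: quotient_module_simps)
    show "zero ?M \<in> coset ` ?J" using polys.is_ideal_zero[OF J] by (simp add: quotient_module_simps)
    show "\<ominus>\<^bsub>?M\<^esub> a \<in> coset ` ?J" if "a \<in> coset ` ?J" for a
      using that neg JC polys.is_ideal_uminus[OF J] by auto
    show "a \<oplus>\<^bsub>?M\<^esub> b \<in> coset ` ?J" if "a \<in> coset ` ?J" "b \<in> coset ` ?J" for a b
      using that JC polys.is_ideal_add[OF J] by (auto simp: quotient_module_simps)
    show "r \<odot>\<^bsub>?M\<^esub> a \<in> coset ` ?J" if "r \<in> carrier (mpoly_ring V)" "a \<in> coset ` ?J" for r a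
      using that JC polys.is_ideal_mult[OF J] by (auto simp: quotient_module_simps mpoly_ring_simps)
  qed
  have "{f \<odot>\<^bsub>?M\<^esub> v | f v. f \<in> set fs \<and> v \<in> carrier ?M} \<subseteq> coset ` ?J"
  proof clarify
    fix f v assume f: "f \<in> set fs" and "v \<in> carrier ?M"
    then obtain w where w: "w \<in> polys V" "v = coset w" by (auto simp: quotient_module_simps)
    have "w * f \<in> ?J"
      using polys.is_ideal_mult[OF J w(1)] polys.set_subset_foldl_adjoin[OF I fs] f by blast
    then show "f \<odot>\<^bsub>?M\<^esub> v \<in> coset ` ?J"
      using f fs w by (auto simp: quotient_module_simps subset_iff mult.commute)
  qed
  with sub have le: "smult_submodule (mpoly_ring V) ?M (set fs) \<subseteq> coset ` ?J"
    unfolding smult_submodule_def by blast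
  show "u \<in> ?J" if cu: "coset u \<in> smult_submodule (mpoly_ring V) ?M (set fs)"
  proof -
    obtain v where v: "v \<in> ?J" "coset u = coset v" using cu le by blast
    then have "u - v \<in> ?J" using IJ coset_eq_iff by blast
    from polys.is_ideal_add[OF J this v(1)] show ?thesis by simp
  qed
  show "coset u \<in> smult_submodule (mpoly_ring V) ?M (set fs)" if uJ: "u \<in> ?J"
    unfolding smult_submodule_def
  proof clarify
    fix N assume N: "submodule N (mpoly_ring V) ?M"
      and gens: "{f \<odot>\<^bsub>?M\<^esub> v | f v. f \<in> set fs \<and> v \<in> carrier ?M} \<subseteq> N"
    note closed = M.submoduleE[OF N]
    have zero: "coset 0 \<in> N"
      using subgroup.one_closed[OF submodule.axioms(1)[OF N]] by (simp add: quotient_module_simps)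
    let ?K = "{v \<in> polys V. coset v \<in> N}"
    have "polys.is_ideal V ?K"
      unfolding polys.is_ideal_def
    proof (intro conjI ballI)
      show "a + b \<in> ?K" if "a \<in> ?K" "b \<in> ?K" for a b
        using that closed(5)[of "coset a" "coset b"] by (simp add: quotient_module_simps)
      show "r * a \<in> ?K" if "r \<in> polys V" "a \<in> ?K" for r a
        using that closed(4)[of r "coset a"] by (simp add: quotient_module_simps mpoly_ring_simps)
    qed (use zero in auto)
    moreover have "I \<subseteq> ?K"
    proof
      fix a assume a: "a \<in> I"
      then have "coset a = coset 0" by (simp add: coset_eq_iff)
      then show "a \<in> ?K" using zero a polys.is_ideal_subset[OF I] by simp
    qed
    moreover have "set fs \<subseteq> ?K"
    proof
      fix f assume f: "f \<in> set fs"
      have "coset 1 \<in> carrier ?M" by (simp add: quotient_module_simps)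
      then have "f \<odot>\<^bsub>?M\<^esub> coset 1 \<in> N" using f gens by blast
      then show "f \<in> ?K" using f fs by (auto simp: quotient_module_simps subset_iff)
    qed
    ultimately have "?J \<subseteq> ?K" by (rule polys.foldl_adjoin_least)
    then show "coset u \<in> N" using uJ by auto
  qed
qed

lemma regular_sequence_quotient_iff:
  "regular_sequence (mpoly_ring V) (quotient_module (mpoly_ring V) I) fs \<longleftrightarrow>
    set fs \<subseteq> polys V \<and> polys.weakly_regular V I fs \<and> 1 \<notin> foldl (polys.adjoin V) I fs"
proof (cases "set fs \<subseteq> polys V")
  case True
  let ?M = "quotient_module (mpoly_ring V) I"
  let ?J = "foldl (polys.adjoin V) I"
  have take: "set (take i fs) \<subseteq> polys V" for i using True set_take_subset[of i fs] by blast
  have nzd: "(\<forall>u\<in>carrier ?M. fs ! i \<odot>\<^bsub>?M\<^esub> u \<in> smult_submodule (mpoly_ring V) ?M (set (take i fs)) \<longrightarrow>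
        u \<in> smult_submodule (mpoly_ring V) ?M (set (take i fs)))
      \<longleftrightarrow> polys.nonzerodivisor_mod V (?J (take i fs)) (fs ! i)" if "i < length fs" for i
  proof -
    have f: "fs ! i \<in> polys V" using that True nth_mem by blast
    show ?thesis
      using f by (simp add: quotient_module_simps polys.nonzerodivisor_mod_def
          coset_mem_smult_submodule_iff[OF take])
  qed
  have J: "polys.is_ideal V (?J fs)" by (rule polys.is_ideal_foldl_adjoin[OF I True])
  have "smult_submodule (mpoly_ring V) ?M (set fs) = carrier ?M \<longleftrightarrow> 1 \<in> ?J fs"
  proof
    assume eq: "smult_submodule (mpoly_ring V) ?M (set fs) = carrier ?M"
    have "coset 1 \<in> carrier ?M" by (simp add: quotient_module_simps)
    then show "1 \<in> ?J fs" using coset_mem_smult_submodule_iff[OF True, of 1] eq by simp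
  next
    assume one: "1 \<in> ?J fs"
    have "u \<in> ?J fs" if "u \<in> polys V" for u
      using polys.is_ideal_mult[OF J that one] by simp
    then have "carrier ?M \<subseteq> smult_submodule (mpoly_ring V) ?M (set fs)"
      using coset_mem_smult_submodule_iff[OF True] by (auto simp: quotient_module_simps)
    moreover have "{f \<odot>\<^bsub>?M\<^esub> u | f u. f \<in> set fs \<and> u \<in> carrier ?M} \<subseteq> carrier ?M"
      using True by (auto simp: mpoly_ring_simps intro!: M.smult_closed)
    then have "smult_submodule (mpoly_ring V) ?M (set fs) \<subseteq> carrier ?M"
      using M.carrier_is_submodule unfolding smult_submodule_def by blast
    ultimately show "smult_submodule (mpoly_ring V) ?M (set fs) = carrier ?M" by blast
  qed
  then show ?thesis
    using True nzd by (simp add: regular_sequence_def polys.weakly_regular_iff mpoly_ring_simps)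
qed (simp add: regular_sequence_def mpoly_ring_simps)

end

section \<open>Square-free powers of the edge ideal of a cycle\<close>

definition edge_power :: "'v ugraph \<Rightarrow> nat \<Rightarrow> ('v, 'k::field) mpoly set" where
  "edge_power G j = edge_ideal G [^]\<^bsub>ideals_set (graph_ring G :: ('v, 'k) mpoly ring)\<^esub> j"

lemma squarefree_power_eq:
  "(squarefree_power G k :: ('v, 'k::field) mpoly set) =
    Idl\<^bsub>graph_ring G\<^esub> {monomial t | t. squarefree_exponent t \<and>
      monomial t \<in> (edge_power G k :: ('v, 'k) mpoly set)}"
  by (simp add: squarefree_power_def edge_power_def)

lemma edge_ideal_generators_subset:
  assumes "simple_graph G"
  shows "{variable x * variable y | x y. {x, y} \<in> edges G} \<subseteq> (polys (verts G) :: ('v, 'k::field) mpoly set)"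
  using assms unfolding simple_graph_def by auto

lemma is_ideal_edge_ideal:
  "simple_graph G \<Longrightarrow> polys.is_ideal (verts G) (edge_ideal G :: ('v, 'k::field) mpoly set)"
  unfolding edge_ideal_def by (intro is_ideal_genideal edge_ideal_generators_subset)

lemma edge_power_0: "edge_power G 0 = (polys (verts G) :: ('v, 'k::field) mpoly set)"
  and edge_power_Suc: "(edge_power G (Suc j) :: ('v, 'k::field) mpoly set) =
    ideal_prod (graph_ring G) (edge_power G j) (edge_ideal G)"
  by (simp_all add: edge_power_def nat_pow_def ideals_set_def mpoly_ring_simps)

lemma is_ideal_edge_power:
  assumes "simple_graph G"
  shows "polys.is_ideal (verts G) (edge_power G j :: ('v, 'k::field) mpoly set)"
proof (induction j)
  case 0
  then show ?case by (simp add: edge_power_0 polys.is_ideal_carrier)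
next
  case (Suc j)
  interpret cring "graph_ring G :: ('v, 'k) mpoly ring" by (rule cring_mpoly_ring)
  show ?case
    using ideal_prod_is_ideal[of "edge_power G j" "edge_ideal G"] Suc is_ideal_edge_ideal[OF assms]
    by (simp add: edge_power_Suc ideal_mpoly_ring_iff)
qed

text \<open>Powers grow by a factor on the right, hence the induction on \<open>b\<close>; within a
  step, elements of the ideal product are treated by its own induction over products and
  sums.\<close>

lemma edge_power_mult:
  assumes G: "simple_graph G"
    and p: "p \<in> edge_power G a" and q: "q \<in> edge_power G b"
  shows "p * q \<in> (edge_power G (a + b) :: ('v, 'k::field) mpoly set)"
  using q
proof (induction b arbitrary: q)
  case 0
  then show ?case
    using polys.is_ideal_mult[OF is_ideal_edge_power[OF G] _ p] by (simp add: edge_power_0 mult.commute[of p])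
next
  case (Suc b)
  from Suc.prems show ?case
    unfolding edge_power_Suc add_Suc_right
  proof (induction q rule: ideal_prod.induct)
    case (prod i e)
    have "(p * i) \<otimes>\<^bsub>graph_ring G\<^esub> e \<in> ideal_prod (graph_ring G) (edge_power G (a + b)) (edge_ideal G)"
      using Suc.IH prod by (intro ideal_prod.prod) auto
    then show ?case by (simp add: mpoly_ring_simps mult.assoc)
  next
    case (sum r s)
    have "p * r \<oplus>\<^bsub>graph_ring G\<^esub> p * s \<in> ideal_prod (graph_ring G) (edge_power G (a + b)) (edge_ideal G)"
      using sum by (intro ideal_prod.sum) auto
    then show ?case by (simp add: mpoly_ring_simps distrib_left)
  qed
qed

lemma edge_power_union:
  assumes "simple_graph G" "finite S" "finite T" "S \<inter> T = {}"
    and "squarefree_monomial S \<in> (edge_power G a :: ('v, 'k::field) mpoly set)"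
    and "squarefree_monomial T \<in> (edge_power G b :: ('v, 'k) mpoly set)"
  shows "squarefree_monomial (S \<union> T) \<in> (edge_power G (a + b) :: ('v, 'k) mpoly set)"
  using edge_power_mult[OF assms(1,5,6)] assms by (simp add: squarefree_monomial_union)

lemma edge_power_edge:
  assumes "simple_graph G" "{x, y} \<in> edges G"
  shows "squarefree_monomial {x, y} \<in> (edge_power G 1 :: ('v, 'k::field) mpoly set)"
proof -
  have "card {x, y} = 2" using assms by (auto simp: simple_graph_def)
  then have "x \<noteq> y" by auto
  then have eq: "squarefree_monomial {x, y} = (variable x * variable y :: ('v, 'k) mpoly)"
    using squarefree_monomial_union[of "{x}" "{y}"] by (simp add: variable_eq insert_commute)
  have "variable x * variable y \<in> (edge_ideal G :: ('v, 'k) mpoly set)"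
    unfolding edge_ideal_def using assms(2) by (intro subsetD[OF subset_genideal]) auto
  then have "1 \<otimes>\<^bsub>graph_ring G\<^esub> (variable x * variable y)
      \<in> ideal_prod (graph_ring G) (edge_power G 0) (edge_ideal G :: ('v, 'k) mpoly set)"
    by (intro ideal_prod.prod) (simp_all add: edge_power_0)
  then have "1 \<otimes>\<^bsub>graph_ring G\<^esub> (variable x * variable y) \<in> (edge_power G (Suc 0) :: ('v, 'k) mpoly set)"
    by (simp only: edge_power_Suc)
  then show ?thesis by (simp add: eq mpoly_ring_simps)
qed

section \<open>Monomials of matchings in an even cycle\<close>

abbreviation odds :: "nat set" where "odds \<equiv> {i. odd i}"
abbreviation evens :: "nat set" where "evens \<equiv> {i. even i}"

lemma verts_cycle_graph [simp]: "verts (cycle_graph n) = {1..n}"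
  by (simp add: cycle_graph_def)

text \<open>A path with \<open>2 * q\<close> vertices is matched by consecutive pairs. The interval
  is open on the left so that \<open>q = 0\<close> gives the empty set.\<close>

lemma edge_power_segment:
  assumes n: "3 \<le> n" and a: "a + 2 * q \<le> n"
  shows "squarefree_monomial {a<..a + 2 * q} \<in> (edge_power (cycle_graph n) q :: (nat, 'k::field) mpoly set)"
  using a
proof (induction q)
  case 0
  then show ?case
    by (simp add: edge_power_0)
next
  case (Suc q)
  note G = simple_graph_cycle[OF n]
  let ?x = "Suc (a + 2 * q)"
  have "{?x, Suc ?x} \<in> edges (cycle_graph n)"
    using Suc.prems by (auto simp: cycle_graph_def intro!: exI[of _ ?x])
  then have 1: "squarefree_monomial {?x, Suc ?x} \<in> (edge_power (cycle_graph n) 1 :: (nat, 'k) mpoly set)"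
    by (rule edge_power_edge[OF G])
  have 2: "squarefree_monomial {a<..a + 2 * q} \<in> (edge_power (cycle_graph n) q :: (nat, 'k) mpoly set)"
    using Suc by simp
  have "{a<..a + 2 * Suc q} = {a<..a + 2 * q} \<union> {?x, Suc ?x}" by auto
  then show ?case using edge_power_union[OF G _ _ _ 2 1] by simp
qed

lemma edge_power_omit_two:
  assumes m: "2 \<le> m" and i: "odd i" "i \<le> 2 * m" and j: "even j" "1 \<le> j" "j \<le> 2 * m"
  shows "squarefree_monomial ({1..2 * m} - {i, j})
    \<in> (edge_power (cycle_graph (2 * m)) (m - 1) :: (nat, 'k::field) mpoly set)"
proof -
  let ?G = "cycle_graph (2 * m)"
  have n: "3 \<le> 2 * m" using m by simp
  note G = simple_graph_cycle[OF n]
  note segment = edge_power_segment[OF n, where 'k = 'k]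
  obtain s where s: "i = 2 * s + 1" using i by (elim oddE)
  obtain t where t: "j = 2 * t" using j by (elim evenE)
  show ?thesis
  proof (cases "i < j")
    case True
    have "squarefree_monomial (({0<..0 + 2 * s} \<union> {i<..i + 2 * (t - s - 1)}) \<union> {j<..j + 2 * (m - t)})
        \<in> (edge_power ?G ((s + (t - s - 1)) + (m - t)) :: (nat, 'k) mpoly set)"
      using True i j s t by (intro edge_power_union[OF G] segment) auto
    moreover have "({0<..0 + 2 * s} \<union> {i<..i + 2 * (t - s - 1)}) \<union> {j<..j + 2 * (m - t)} = {1..2 * m} - {i, j}"
      using True j s t by auto
    moreover have "(s + (t - s - 1)) + (m - t) = m - 1" using True j s t by auto
    ultimately show ?thesis by simp
  next
    case False
    \<comment> \<open>Here the even vertex \<open>j\<close> precedes \<open>i\<close>, so the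
      stretches before \<open>j\<close> and after \<open>i\<close> both have odd length. The closing
      edge takes one vertex from each and leaves even segments.\<close>
    have "{1, 2 * m} \<in> edges ?G" by (simp add: cycle_graph_def)
    note e = edge_power_edge[OF G this, where 'k = 'k]
    have "squarefree_monomial ((({1<..1 + 2 * (t - 1)} \<union> {j<..j + 2 * (s - t)})
          \<union> {i<..i + 2 * (m - 1 - s)}) \<union> {1, 2 * m})
        \<in> (edge_power ?G (((t - 1) + (s - t)) + (m - 1 - s) + 1) :: (nat, 'k) mpoly set)"
      using False i j s t by (intro edge_power_union[OF G] segment e) auto
    moreover have "(({1<..1 + 2 * (t - 1)} \<union> {j<..j + 2 * (s - t)})
          \<union> {i<..i + 2 * (m - 1 - s)}) \<union> {1, 2 * m} = {1..2 * m} - {i, j}"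
    proof -
      have "i \<noteq> 2 * m" "i \<noteq> j" using i(1) j(1) by auto
      then have bounds: "2 \<le> j" "j < i" "i < 2 * m" using False i j t by auto
      have ends: "1 + 2 * (t - 1) = j - 1" "j + 2 * (s - t) = i - 1" "i + 2 * (m - 1 - s) = 2 * m - 1"
        using bounds s t by auto
      show ?thesis unfolding ends using bounds by auto
    qed
    moreover have "((t - 1) + (s - t)) + (m - 1 - s) + 1 = m - 1" using False i j s t m by auto
    ultimately show ?thesis by (simp only:)
  qed
qed

text \<open>For a vertex cover \<open>A\<close> every edge contributes at least one to the degree in
  \<open>A\<close>. The polynomials \<open>B j\<close> whose terms all have \<open>A\<close>-degree
  at least \<open>j\<close> form ideals, with \<open>B i\<close> times \<open>B j\<close> inside
  \<open>B (i + j)\<close>.\<close>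

lemma degree_edge_power:
  assumes G: "simple_graph G"
    and cover: "\<And>x y. {x, y} \<in> edges G \<Longrightarrow> total_degree A (Poly_Mapping.single x 1 + Poly_Mapping.single y 1) \<ge> 1"
    and p: "p \<in> (edge_power G k :: ('v, 'k::field) mpoly set)" "m \<in> Poly_Mapping.keys p"
  shows "k \<le> total_degree A m"
proof -
  define B where "B j = {p \<in> polys (verts G) :: ('v, 'k) mpoly set.
      \<forall>m\<in>Poly_Mapping.keys p. j \<le> total_degree A m}" for j
  have B_mult: "p * q \<in> B (i + j)" if p: "p \<in> B i" and q: "q \<in> B j" for p q i j
    unfolding B_def
  proof (intro CollectI conjI ballI)
    show "p * q \<in> polys (verts G)" using p q by (simp add: B_def)
    fix m assume "m \<in> Poly_Mapping.keys (p * q)"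
    then obtain a b where "m = a + b" "a \<in> Poly_Mapping.keys p" "b \<in> Poly_Mapping.keys q"
      using Poly_Mapping.keys_mult[of p q] by blast
    then show "i + j \<le> total_degree A m"
      using p q by (simp add: B_def total_degree_add add_mono)
  qed
  have B_add: "p + q \<in> B j" if "p \<in> B j" "q \<in> B j" for p q j
    using that Poly_Mapping.keys_add[of p q] by (auto simp: B_def)
  have B0: "B 0 = polys (verts G)" by (simp add: B_def)
  have ideal: "polys.is_ideal (verts G) (B j)" for j
    unfolding polys.is_ideal_def
  proof (intro conjI ballI)
    show "B j \<subseteq> polys (verts G)" "0 \<in> B j" by (auto simp: B_def)
    show "r * p \<in> B j" if "r \<in> polys (verts G)" "p \<in> B j" for r p
      using B_mult[of r 0 p j] that by (simp add: B0)
  qed (rule B_add)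
  have E: "edge_ideal G \<subseteq> B 1"
    unfolding edge_ideal_def
  proof (rule genideal_least[OF ideal])
    show "{variable x * variable y | x y. {x, y} \<in> edges G} \<subseteq> B 1"
    proof clarify
      fix x y assume e: "{x, y} \<in> edges G"
      have "variable x * variable y = (monomial (Poly_Mapping.single x 1 + Poly_Mapping.single y 1) :: ('v, 'k) mpoly)"
        by (simp add: variable_def monomial_add)
      moreover have "variable x * variable y \<in> (polys (verts G) :: ('v, 'k) mpoly set)"
        using edge_ideal_generators_subset[OF G] e by blast
      ultimately show "variable x * variable y \<in> B 1"
        using cover[OF e] by (simp add: B_def)
    qed
  qed
  have "edge_power G j \<subseteq> B j" for j
  proof (induction j)
    case 0
    then show ?case by (simp add: edge_power_0 B0)
  next
    case (Suc j)
    show ?case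
    proof
      fix p :: "('v, 'k) mpoly" assume "p \<in> edge_power G (Suc j)"
      then show "p \<in> B (Suc j)"
        unfolding edge_power_Suc
      proof (induction p rule: ideal_prod.induct)
        case (prod i e)
        then show ?case using B_mult[of i j e 1] Suc E by (auto simp: mpoly_ring_simps)
      next
        case (sum r s)
        then show ?case using B_add by (simp add: mpoly_ring_simps)
      qed
    qed
  qed
  then show ?thesis using p by (auto simp: B_def)
qed

lemma cycle_edge_parity:
  assumes "even n" "{x, y} \<in> edges (cycle_graph n)"
  shows "odd x \<noteq> odd y"
  using assms by (auto simp: cycle_graph_def doubleton_eq_iff)

lemma total_degree_squarefree:
  assumes A: "finite A" and m: "squarefree_exponent m"
  shows "total_degree A m = card (Poly_Mapping.keys m \<inter> A)"
proof -
  have "Poly_Mapping.lookup m x = (if x \<in> Poly_Mapping.keys m then 1 else 0)" for x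
    using m[unfolded squarefree_exponent_def, rule_format, of x] by (auto simp: in_keys_iff)
  then have "total_degree A m = (\<Sum>x\<in>A. if x \<in> Poly_Mapping.keys m then 1 else 0)"
    by (simp add: total_degree_def)
  also have "\<dots> = card (A \<inter> Poly_Mapping.keys m)" using A by (simp flip: sum.inter_restrict)
  finally show ?thesis by (simp add: Int_commute)
qed

lemma card_parity_class:
  "card ({1..2 * m} \<inter> odds) = m" "card ({1..2 * m} \<inter> evens) = m"
proof -
  have "{1..2 * m} \<inter> odds = (\<lambda>i. 2 * i + 1) ` {..<m}" by (auto elim!: oddE)
  then show "card ({1..2 * m} \<inter> odds) = m" by (simp add: card_image inj_on_def)
  have "{1..2 * m} \<inter> evens = (\<lambda>i. 2 * i) ` {1..m}" by (auto elim!: evenE)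
  then show "card ({1..2 * m} \<inter> evens) = m" by (simp add: card_image inj_on_def)
qed

text \<open>Odd and even vertices are both vertex covers of size \<open>m\<close>. A square-free
  monomial of degree at least \<open>m - 1\<close> in each class misses at most one vertex of each;
  the converse is \<open>edge_power_omit_two\<close>.\<close>

lemma squarefree_power_cycle:
  assumes m: "2 \<le> m"
  shows "(squarefree_power (cycle_graph (2 * m)) (m - 1) :: (nat, 'k::field) mpoly set)
    = squarefree_ideal {1..2 * m} (misses_few odds evens {1..2 * m})"
    (is "?I = ?J")
proof
  let ?G = "cycle_graph (2 * m)" and ?V = "{1..2 * m}"
  have G: "simple_graph ?G" using m by (intro simple_graph_cycle) simp
  have up: "upward_closed ?V (misses_few odds evens ?V)" by (rule upward_closed_misses_few) simp
  have gens: "{monomial t | t. squarefree_exponent t \<and>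
        monomial t \<in> (edge_power ?G (m - 1) :: (nat, 'k) mpoly set)}
      \<subseteq> (polys ?V :: (nat, 'k) mpoly set)" (is "?gens \<subseteq> _")
    using polys.is_ideal_subset[OF is_ideal_edge_power[OF G]] by fastforce
  show "?I \<subseteq> ?J"
    unfolding squarefree_power_eq verts_cycle_graph
  proof (rule genideal_least[OF is_ideal_squarefree_ideal[OF up]], clarify)
    fix t :: "nat \<Rightarrow>\<^sub>0 nat"
    assume t: "squarefree_exponent t" "monomial t \<in> (edge_power ?G (m - 1) :: (nat, 'k) mpoly set)"
    have tV: "Poly_Mapping.keys t \<subseteq> ?V"
      using polys.is_ideal_subset[OF is_ideal_edge_power[OF G] t(2)] by simp
    have few: "card ((?V - Poly_Mapping.keys t) \<inter> W) \<le> 1"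
      if W: "card (?V \<inter> W) = m"
        and cover: "\<And>x y. {x, y} \<in> edges ?G \<Longrightarrow> x \<in> W \<or> y \<in> W" for W
    proof -
      have "m - 1 \<le> total_degree (?V \<inter> W) t"
      proof (rule degree_edge_power[OF G _ t(2)])
        fix x y assume e: "{x, y} \<in> edges ?G"
        then have "{x, y} \<subseteq> ?V" using G by (auto simp: simple_graph_def)
        with cover[OF e] obtain z where z: "z \<in> {x, y}" "z \<in> ?V \<inter> W" by auto
        have "total_degree (?V \<inter> W) (Poly_Mapping.single z 1)
            = (\<Sum>w\<in>?V \<inter> W. if w = z then 1 else 0)"
          unfolding total_degree_def by (intro sum.cong) (auto simp: lookup_single when_def)
        also have "\<dots> = 1" using z by (simp add: sum.delta)
        finally show "1 \<le> total_degree (?V \<inter> W) (Poly_Mapping.single x 1 + Poly_Mapping.single y 1)"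
          using z by (auto simp: total_degree_add)
      qed simp
      then have "m - 1 \<le> card (Poly_Mapping.keys t \<inter> (?V \<inter> W))"
        using t by (simp add: total_degree_squarefree)
      moreover have "(?V - Poly_Mapping.keys t) \<inter> W = (?V \<inter> W) - (Poly_Mapping.keys t \<inter> (?V \<inter> W))"
        by auto
      moreover have "card ((?V \<inter> W) - (Poly_Mapping.keys t \<inter> (?V \<inter> W)))
          = card (?V \<inter> W) - card (Poly_Mapping.keys t \<inter> (?V \<inter> W))"
        by (rule card_Diff_subset) auto
      ultimately show ?thesis unfolding W by simp
    qed
    have "card ((?V - Poly_Mapping.keys t) \<inter> odds) \<le> 1"
      by (rule few) (use card_parity_class cycle_edge_parity[of "2 * m"] in auto)
    moreover have "card ((?V - Poly_Mapping.keys t) \<inter> evens) \<le> 1"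
      by (rule few) (use card_parity_class cycle_edge_parity[of "2 * m"] in auto)
    ultimately show "monomial t \<in> ?J"
      using tV by (simp add: monomial_mem_squarefree_ideal misses_few_def)
  qed
  show "?J \<subseteq> ?I"
  proof (rule squarefree_ideal_subset)
    show "polys.is_ideal ?V ?I"
      unfolding squarefree_power_eq verts_cycle_graph by (rule is_ideal_genideal[OF gens])
    fix S assume S: "finite S" "S \<subseteq> ?V" "misses_few odds evens ?V S"
    \<comment> \<open>The support may contain a whole parity class. Then any vertex of that class is
      dropped, so that the generator always omits exactly one vertex per class.\<close>
    have pick: "\<exists>i\<in>W. (?V - S) \<inter> W \<subseteq> {i} \<and> i \<in> ?V"
      if "card ((?V - S) \<inter> W) \<le> 1" "?V \<inter> W \<noteq> {}" for W
    proof (cases "(?V - S) \<inter> W = {}")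
      case True
      then show ?thesis using that(2) by blast
    next
      case False
      then have "card ((?V - S) \<inter> W) = 1" using that(1) by (simp add: le_Suc_eq)
      then obtain i where "(?V - S) \<inter> W = {i}" by (rule card_1_singletonE)
      then show ?thesis by (intro bexI[of _ i]) auto
    qed
    have "1 \<in> ?V \<inter> odds" "2 \<in> ?V \<inter> evens" using m by auto
    then have "?V \<inter> odds \<noteq> {}" "?V \<inter> evens \<noteq> {}" by blast+
    moreover have "card ((?V - S) \<inter> odds) \<le> 1" "card ((?V - S) \<inter> evens) \<le> 1"
      using S(3) unfolding misses_few_def by blast+
    ultimately have "\<exists>i\<in>odds. (?V - S) \<inter> odds \<subseteq> {i} \<and> i \<in> ?V" "\<exists>j\<in>evens. (?V - S) \<inter> evens \<subseteq> {j} \<and> j \<in> ?V"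
      using pick by blast+
    then obtain i j where i: "odd i" "(?V - S) \<inter> odds \<subseteq> {i}" "i \<in> ?V"
      and j: "even j" "(?V - S) \<inter> evens \<subseteq> {j}" "j \<in> ?V"
      by blast
    have sub: "?V - {i, j} \<subseteq> S" using i j by auto
    have "squarefree_exponent (indicator_exponent (?V - {i, j}))"
      by (simp add: squarefree_exponent_def lookup_indicator_exponent)
    moreover have "squarefree_monomial (?V - {i, j}) \<in> (edge_power ?G (m - 1) :: (nat, 'k) mpoly set)"
      using i j by (intro edge_power_omit_two[OF m]) auto
    ultimately have "squarefree_monomial (?V - {i, j}) \<in> ?I"
      unfolding squarefree_power_eq verts_cycle_graph squarefree_monomial_def
      by (intro subsetD[OF subset_genideal]) auto
    then show "\<exists>A\<subseteq>S. squarefree_monomial A \<in> ?I" using sub by blast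
  qed
qed

section \<open>The matching number of an even cycle\<close>

lemma matching_number_cycle:
  assumes m: "2 \<le> m"
  shows "matching_number (cycle_graph (2 * m)) = m"
proof -
  let ?G = "cycle_graph (2 * m)"
  have G: "simple_graph ?G" using m by (intro simple_graph_cycle) simp
  have edges: "edges ?G \<subseteq> Pow {1..2 * m}" using G by (auto simp: simple_graph_def)
  have le: "card M \<le> m" if "matching ?G M" for M
  proof -
    have M: "M \<subseteq> edges ?G" "disjoint M" using that by (auto simp: matching_def)
    have fin: "finite e" if "e \<in> M" for e
      using that M edges by (meson PowD finite_atLeastAtMost finite_subset subsetD)
    have "2 * card M = (\<Sum>e\<in>M. card e)" using M G by (auto simp: simple_graph_def subset_iff)
    also have "\<dots> = card (\<Union> M)"
      using M fin by (intro card_Union_disjoint[symmetric]) (auto simp: disjoint_def pairwise_def disjnt_def)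
    also have "\<dots> \<le> card {1..2 * m}" using M edges by (intro card_mono) auto
    finally show ?thesis by simp
  qed
  have ex: "\<exists>M. m = card M \<and> matching ?G M"
  proof (intro exI conjI)
    let ?e = "\<lambda>i. {2 * i - 1, 2 * i} :: nat set"
    show "matching ?G (?e ` {1..m})"
      unfolding matching_def
    proof
      show "?e ` {1..m} \<subseteq> edges ?G"
      proof clarify
        fix i assume i: "i \<in> {1..m}"
        then have "?e i = {2 * i - 1, (2 * i - 1) + 1}" by auto
        then show "?e i \<in> edges ?G" using i unfolding cycle_graph_def by auto
      qed
      \<comment> \<open>The index of a pair is recovered from either of its elements, so distinct
        pairs are disjoint.\<close>
      have half: "(x + 1) div 2 = i" if "x \<in> ?e i" "1 \<le> i" for x i
        using that by auto
      show "disjoint (?e ` {1..m})"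
        unfolding disjoint_def
      proof (intro ballI impI)
        fix A B assume "A \<in> ?e ` {1..m}" "B \<in> ?e ` {1..m}" "A \<noteq> B"
        obtain i where i: "A = ?e i" "i \<in> {1..m}" using \<open>A \<in> _\<close> by blast
        obtain j where j: "B = ?e j" "j \<in> {1..m}" using \<open>B \<in> _\<close> by blast
        have "i \<noteq> j" using \<open>A \<noteq> B\<close> i j by blast
        then show "A \<inter> B = {}" using half[of _ i] half[of _ j] i j by fastforce
      qed
    qed
    have "inj_on ?e {1..m}"
    proof (rule inj_onI)
      fix i j assume "i \<in> {1..m}" "j \<in> {1..m}" "?e i = ?e j"
      moreover have "Max (?e i) = 2 * i" "Max (?e j) = 2 * j" by auto
      ultimately show "i = j" by (metis mult_left_cancel zero_neq_numeral)
    qed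
    then show "m = card (?e ` {1..m})" by (simp add: card_image)
  qed
  have "{card M | M. matching ?G M} \<subseteq> {..m}" using le by blast
  then have "finite {card M | M. matching ?G M}" by (rule finite_subset) simp
  moreover have "m \<in> {card M | M. matching ?G M}" using ex by (rule CollectI)
  ultimately show ?thesis
    unfolding matching_number_def using le by (intro Max_eqI) blast+
qed

section \<open>A Koszul cycle and the depth\<close>

text \<open>The four-cycle \<open>1, 2, 3, 4\<close> in the complete bipartite graph on odd and even vertices is
  filled by the triangles \<open>{1, 2, 3}\<close> and \<open>{1, 3, 4}\<close>, whose common edge \<open>{1, 3}\<close> cancels.\<close>

definition square_cycle :: "nat \<Rightarrow> nat set \<Rightarrow> (nat, 'k::field) mpoly" where
  "square_cycle n S = (if S = {1, 2, 3} \<or> S = {1, 3, 4} then squarefree_monomial ({1..n} - S) else 0)"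

lemma koszul_polys: "finite V \<Longrightarrow> koszul (polys V :: ('v::linorder, 'k::field) mpoly set) V variable"
  by unfold_locales auto

lemma misses_few_mono:
  "upward_closed V (misses_few A B V) \<Longrightarrow> misses_few A B V S \<Longrightarrow> S \<subseteq> T \<Longrightarrow> T \<subseteq> V \<Longrightarrow> misses_few A B V T"
  unfolding upward_closed_def by blast

text \<open>If the chain were \<open>bd w\<close> plus a chain over \<open>I\<close>, its boundary
  would be the boundary of a chain over \<open>I\<close>. This is refuted at a single face, whatever
  \<open>w\<close> is, since the bipartite graph has no triangles.\<close>

lemma nonbounding_square_cycle:
  fixes n :: nat
  assumes n: "4 \<le> n"
  defines "V \<equiv> {1..n}"
  shows "koszul.nonbounding_cycle (polys V :: (nat, 'k::field) mpoly set) V variable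
    (squarefree_ideal V (misses_few odds evens V)) 3 (square_cycle n)"
proof -
  interpret koszul "polys V :: (nat, 'k) mpoly set" V variable
    by (rule koszul_polys) (simp add: V_def)
  let ?I = "squarefree_ideal V (misses_few odds evens V) :: (nat, 'k) mpoly set"
  let ?z = "square_cycle n :: nat set \<Rightarrow> (nat, 'k) mpoly"
  have finV: "finite V" by (simp add: V_def)
  have up: "upward_closed V (misses_few odds evens V)" by (rule upward_closed_misses_few[OF finV])
  note I = is_ideal_squarefree_ideal[OF up, where 'k = 'k]
  have z: "?z S = (if S = {1, 2, 3} \<or> S = {1, 3, 4} then squarefree_monomial (V - S) else 0)" for S
    by (simp add: square_cycle_def V_def)
  have small: "1 \<in> V" "2 \<in> V" "3 \<in> V" "4 \<in> V" using n by (auto simp: V_def)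
  have face: "variable x * ?z (insert x S) = squarefree_monomial (V - S)"
    if "x \<in> V - S" "insert x S = {1, 2, 3} \<or> insert x S = {1, 3, 4}" for x S
  proof -
    have "V - S = {x} \<union> (V - insert x S)" using that by auto
    moreover have "squarefree_monomial ({x} \<union> (V - insert x S))
        = squarefree_monomial {x} * (squarefree_monomial (V - insert x S) :: (nat, 'k) mpoly)"
      using finV by (intro squarefree_monomial_union) auto
    ultimately show ?thesis using that by (simp add: z variable_eq)
  qed
  have chain: "chain 3 ?z"
    using finV small by (auto simp: chain_def z)
  have cycle: "bd ?z S \<in> ?I" for S
  proof (cases "S = {1, 3}")
    case True
    have "bd ?z S = (\<Sum>x\<in>{2, 4}. sgn_at x S * variable x * ?z (insert x S))"
      unfolding bd_def
    proof (rule sum.mono_neutral_right)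
      show "\<forall>x\<in>V - S - {2, 4}. sgn_at x S * variable x * ?z (insert x S) = 0"
      proof
        fix x assume x: "x \<in> V - S - {2, 4}"
        then have "x \<in> insert x S" "x \<notin> {1, 2, 3}" "x \<notin> {1, 3, 4}" using True by auto
        then have "insert x S \<noteq> {1, 2, 3}" "insert x S \<noteq> {1, 3, 4}" by blast+
        then show "sgn_at x S * variable x * ?z (insert x S) = 0" by (simp add: z)
      qed
    qed (use finV small True in auto)
    moreover have "variable 2 * ?z (insert 2 S) = squarefree_monomial (V - S)"
      "variable 4 * ?z (insert 4 S) = squarefree_monomial (V - S)"
      using small True by (intro face; auto)+
    \<comment> \<open>In \<open>{1, 3}\<close> the vertex 2 has one predecessor and 4 has two, so
      the two triangles meet their common edge with opposite signs and both may carry coefficient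
      sign plus.\<close>
    moreover have "{y \<in> V. y \<in> S \<and> y < 2} = {1}" "{y \<in> V. y \<in> S \<and> y < 4} = {1, 3}"
      using small True by auto
    then have "sgn_at 2 S = - 1" "sgn_at 4 S = 1" by (simp_all add: sgn_at_def)
    ultimately have "bd ?z S = 0" by (simp add: mult.assoc)
    then show ?thesis using polys.is_ideal_zero[OF I] by simp
  next
    case False
    show ?thesis
      unfolding bd_def
    proof (rule polys.is_ideal_sum[OF I])
      fix x assume x: "x \<in> V - S"
      show "sgn_at x S * variable x * ?z (insert x S) \<in> ?I"
      proof (cases "insert x S = {1, 2, 3} \<or> insert x S = {1, 3, 4}")
        case True
        have sub: "S = T - {x}" "x \<in> T" if "insert x S = T" for T using that x by auto
        from True have "S \<in> {{1, 2}, {2, 3}, {1, 4}, {3, 4}, {1, 3}}"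
        proof
          assume T: "insert x S = {1, 2, 3}"
          then have "x = 1 \<or> x = 2 \<or> x = 3" using sub(2)[OF T] by simp
          then show ?thesis using sub(1)[OF T] by (elim disjE) (simp_all add: insert_Diff_if)
        next
          assume T: "insert x S = {1, 3, 4}"
          then have "x = 1 \<or> x = 3 \<or> x = 4" using sub(2)[OF T] by simp
          then show ?thesis using sub(1)[OF T] by (elim disjE) (simp_all add: insert_Diff_if)
        qed
        with False have "S = {1, 2} \<or> S = {2, 3} \<or> S = {1, 4} \<or> S = {3, 4}" by blast
        \<comment> \<open>Only edges of the four-cycle are left. Each has one odd and one even
          vertex, so the monomial of its complement lies in the ideal.\<close>
        then have S: "S \<subseteq> V" "card (S \<inter> odds) \<le> 1" "card (S \<inter> evens) \<le> 1"
          using small by (elim disjE; simp)+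
        moreover have "V - (V - S) = S" using S(1) by auto
        ultimately have "misses_few odds evens V (V - S)" by (simp add: misses_few_def)
        then have "squarefree_monomial (V - S) \<in> ?I"
          using finV by (simp add: squarefree_monomial_mem_squarefree_ideal)
        then show ?thesis
          using polys.is_ideal_mult[OF I sgn_at_mem] face[OF x True] by (simp add: mult.assoc)
      next
        case False
        then show ?thesis using polys.is_ideal_zero[OF I] by (simp add: z)
      qed
    qed
  qed
  have nonbounding: False if w: "chain_in (polys V) w" and zw: "chain_in ?I (\<lambda>S. ?z S - bd w S)" for w
  proof -
    let ?d = "\<lambda>S. ?z S - bd w S"
    \<comment> \<open>The test face: it lies in the triangle \<open>{1, 2, 3}\<close> only, so
      nothing cancels there.\<close>
    let ?S = "{1, 2} :: nat set"
    let ?e = "indicator_exponent (V - ?S)"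
    have "bd ?z ?S = (\<Sum>x\<in>{3}. sgn_at x ?S * variable x * ?z (insert x ?S))"
      unfolding bd_def
    proof (rule sum.mono_neutral_right)
      show "\<forall>x\<in>V - ?S - {3}. sgn_at x ?S * variable x * ?z (insert x ?S) = 0"
      proof
        fix x assume "x \<in> V - ?S - {3}"
        then have "x \<notin> {1, 2, 3}" by simp
        then have "insert x ?S \<noteq> {1, 2, 3}" by blast
        moreover have "2 \<in> insert x ?S" "2 \<notin> {1, 3, 4 :: nat}" by simp_all
        then have "insert x ?S \<noteq> {1, 3, 4}" by blast
        ultimately show "sgn_at x ?S * variable x * ?z (insert x ?S) = 0" by (simp add: z)
      qed
    qed (use finV small in auto)
    also have "\<dots> = sgn_at 3 ?S * squarefree_monomial (V - ?S)"
      using face[of 3 ?S] small by (simp add: mult.assoc insert_commute)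
    also have "{y \<in> V. y \<in> ?S \<and> y < 3} = ?S" using small by auto
    then have "sgn_at 3 ?S = 1" by (simp add: sgn_at_def)
    finally have "bd ?z ?S = squarefree_monomial (V - ?S)" by simp
    moreover have "bd ?d ?S = bd ?z ?S" by (simp add: bd_diff bd_bd)
    ultimately have "Poly_Mapping.lookup (bd ?d ?S) ?e = 1"
      by (simp add: squarefree_monomial_def monomial_def)
    \<comment> \<open>Some summand must contain this monomial. It is \<open>x\<close> times a
      monomial of the ideal missing 1, 2 and \<open>x\<close>, but among these three vertices two
      have the same parity.\<close>
    then obtain x where x: "x \<in> V - ?S"
      and "Poly_Mapping.lookup (sgn_at x ?S * variable x * ?d (insert x ?S)) ?e \<noteq> 0"
      unfolding bd_def lookup_sum by (metis (no_types, lifting) sum.neutral zero_neq_one)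
    moreover define q where "q = sgn_at x ?S * ?d (insert x ?S)"
    ultimately have "?e \<in> Poly_Mapping.keys (monomial (Poly_Mapping.single x 1) * q)"
      by (simp add: in_keys_iff variable_def ac_simps)
    then obtain t where t: "t \<in> Poly_Mapping.keys q" "?e = Poly_Mapping.single x 1 + t"
      by (auto simp: keys_monomial_mult)
    have "q \<in> ?I"
      unfolding q_def using zw by (intro polys.is_ideal_mult[OF I]) (auto simp: chain_in_def)
    then have few: "misses_few odds evens V (Poly_Mapping.keys t)"
      using t(1) by (simp add: squarefree_ideal_def)
    have "Poly_Mapping.lookup ?e x = 1" using x finV by (simp add: lookup_indicator_exponent)
    then have "x \<notin> Poly_Mapping.keys t" unfolding t(2) by (simp add: lookup_add in_keys_iff)
    moreover have "Poly_Mapping.keys t \<subseteq> Poly_Mapping.keys ?e"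
      unfolding t(2) keys_add_nat by blast
    then have "Poly_Mapping.keys t \<subseteq> V - ?S" using finV by simp
    ultimately have "Poly_Mapping.keys t \<subseteq> V - {1, 2, x}" by auto
    with few have "misses_few odds evens V (V - {1, 2, x})"
      by (rule misses_few_mono[OF up]) auto
    moreover have "V - (V - {1, 2, x}) = {1, 2, x}" using small x by auto
    ultimately have card: "card ({1, 2, x} \<inter> odds) \<le> 1" "card ({1, 2, x} \<inter> evens) \<le> 1"
      by (simp_all add: misses_few_def)
    show False
    proof (cases "odd x")
      case True
      then have "{1, 2, x} \<inter> odds = {1, x}" by auto
      then show False using card(1) x by simp
    next
      case False
      then have "{1, 2, x} \<inter> evens = {2, x}" by auto
      then show False using card(2) x by simp
    qed
  qed
  show ?thesis
    unfolding nonbounding_cycle_def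
  proof (intro conjI chain)
    show "chain_in ?I (bd ?z)" using cycle by (simp add: chain_in_def)
  qed (use nonbounding in blast)
qed

lemma depth_misses_few_odds_evens:
  fixes n :: nat
  assumes n: "4 \<le> n"
  shows "depth {1..n} (quotient_module (mpoly_ring {1..n})
    (squarefree_ideal {1..n} (misses_few odds evens {1..n}) :: (nat, 'k::field) mpoly set)) = enat (n - 3)"
proof -
  define V where "V = {1..n}"
  have V: "finite V" "card V = n" by (simp_all add: V_def)
  define I where "I = (squarefree_ideal V (misses_few odds evens V) :: (nat, 'k) mpoly set)"
  have I: "polys.is_ideal V I"
    unfolding I_def by (intro is_ideal_squarefree_ideal upward_closed_misses_few V)
  let ?L = "{enat (length fs) | fs. set fs \<subseteq> irrelevant_ideal V \<and>
    regular_sequence (mpoly_ring V) (quotient_module (mpoly_ring V) I) fs}"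
  interpret koszul "polys V :: (nat, 'k) mpoly set" V variable
    by (rule koszul_polys) (rule V)
  have "length fs \<le> n - 3"
    if "set fs \<subseteq> irrelevant_ideal V" "regular_sequence (mpoly_ring V) (quotient_module (mpoly_ring V) I) fs"
    for fs
  proof -
    have "length fs + 3 \<le> card V"
    proof (rule weakly_regular_length_le[OF I])
      show "nonbounding_cycle I 3 (square_cycle n)"
        unfolding I_def V_def by (rule nonbounding_square_cycle[OF n])
      show "polys.weakly_regular V I fs" using that(2) by (simp add: regular_sequence_quotient_iff[OF I])
      show "\<exists>g. (\<forall>x\<in>V. g x \<in> polys V) \<and> f = (\<Sum>x\<in>V. variable x * g x)" if "f \<in> set fs" for f
        using that \<open>set fs \<subseteq> _\<close> by (intro irrelevant_ideal_sum[OF V(1)]) auto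
    qed
    then show ?thesis by (simp add: V)
  qed
  then have "\<And>l. l \<in> ?L \<Longrightarrow> l \<le> enat (n - 3)" by auto
  moreover have "enat (n - 3) \<in> ?L"
  proof (intro CollectI exI conjI)
    let ?fs = "elementaries V (n - 3) :: (nat, 'k) mpoly list"
    let ?M = "squarefree_ideal V (meets V) :: (nat, 'k) mpoly set"
    have M: "polys.is_ideal V ?M" by (rule is_ideal_squarefree_ideal[OF upward_closed_meets])
    have fsM: "set ?fs \<subseteq> ?M"
      using elementary_mem_squarefree_ideal[OF V(1), where 'k = 'k] by (auto simp: set_elementaries)
    then show "set ?fs \<subseteq> irrelevant_ideal V" using irrelevant_ideal_superset by blast
    \<comment> \<open>Properness: the ideal and the sequence both stay among polynomials without
      constant term. For the ideal this holds because the empty support misses the two odd vertices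
      1 and 3.\<close>
    have "I \<subseteq> ?M"
    proof
      fix p assume p: "p \<in> I"
      have "Poly_Mapping.keys t \<inter> V \<noteq> {}" if "t \<in> Poly_Mapping.keys p" for t
      proof
        assume "Poly_Mapping.keys t \<inter> V = {}"
        then have "V - Poly_Mapping.keys t = V" by auto
        moreover have "misses_few odds evens V (Poly_Mapping.keys t)"
          using p that by (simp add: I_def squarefree_ideal_def)
        ultimately have "card (V \<inter> odds) \<le> 1" unfolding misses_few_def by simp
        moreover have "{1, 3} \<subseteq> V \<inter> odds" using n by (auto simp: V_def)
        then have "card {1, 3 :: nat} \<le> card (V \<inter> odds)" using V by (intro card_mono) auto
        ultimately show False by simp
      qed
      then show "p \<in> ?M" using p by (simp add: I_def squarefree_ideal_def)
    qed
    then have "foldl (polys.adjoin V) I ?fs \<subseteq> ?M" by (rule polys.foldl_adjoin_least[OF M _ fsM])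
    moreover have "1 \<notin> ?M" by (auto simp: squarefree_ideal_def)
    ultimately have "1 \<notin> foldl (polys.adjoin V) I ?fs" by blast
    moreover have "polys.weakly_regular V I ?fs"
      unfolding I_def using n V by (intro weakly_regular_misses_few) auto
    ultimately show "regular_sequence (mpoly_ring V) (quotient_module (mpoly_ring V) I) ?fs"
      using set_elementaries_subset[OF V(1)] by (simp add: regular_sequence_quotient_iff[OF I])
  qed simp
  ultimately have "Sup ?L = enat (n - 3)" by (intro Sup_eqI) auto
  then show ?thesis by (simp add: depth_def grade_def V_def I_def)
qed

theorem proposition4p12:
  fixes n k :: nat
  assumes "n \<ge> 4" and "even n"
    and "k = matching_number (cycle_graph n) - 1"
  shows "k = n div 2 - 1 \<and>
         depth (verts (cycle_graph n))
           (quotient_module (graph_ring (cycle_graph n))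
              (squarefree_power (cycle_graph n) k :: (nat, 'k::field) mpoly set))
         = enat (2 * k - 1)"
proof -
  obtain m where m: "n = 2 * m" using \<open>even n\<close> by (elim evenE)
  then have "2 \<le> m" using \<open>n \<ge> 4\<close> by simp
  then have k: "k = m - 1" using assms(3) by (simp add: m matching_number_cycle)
  have "depth (verts (cycle_graph n)) (quotient_module (graph_ring (cycle_graph n))
      (squarefree_power (cycle_graph n) k :: (nat, 'k) mpoly set)) = enat (n - 3)"
    using depth_misses_few_odds_evens[OF \<open>n \<ge> 4\<close>, where 'k = 'k]
      squarefree_power_cycle[OF \<open>2 \<le> m\<close>, where 'k = 'k]
    by (simp add: m k)
  moreover have "n - 3 = 2 * k - 1" using \<open>2 \<le> m\<close> by (simp add: m k)
  ultimately show ?thesis using m k by simp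
qed

end
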